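(* The functional $$J:W^{1,4}(0,1)\to[0,\infty],\qquad J(u)=\int_0^1\left(\frac{u^2(u-x)^2}{x^5}+\frac{\big((u')^2-1\big)^2}{x}+u^2\right)dx$$ satisfies $$\inf_{u\in W^{1,\infty}(0,1)}J(u)=\inf_{u\in W^{1,4}(0,1)}J(u)=0,\qquad \inf_{u\in\mathcal B}J(u)>0 .$$
   Context: Let $\sigma(z)=\max\{z,0\}$. The (representational) Barron space $\mathcal B=\mathcal B(\mathbb R)$ is the space of functions $f:\mathbb R\to\mathbb R$ of the form $f(x)=\int_{S^1}\sigma(w\cdot(x,1))\,d\mu(w)$, where $\mu$ is a finite signed Borel measure on the unit circle $S^1\subset\mathbb R^2$. Barron functions are Lipschitz continuous, and $J$ is evaluated on their restrictions to $(0,1)$. (Known fact: a function on a bounded interval is the restriction of a Barron function if and only if it is weakly differentiable and its derivative is a function of bounded variation on the interval.) *)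

theory Defs
  imports "HOL-Analysis.Analysis"
begin

section \<open>Sobolev spaces on open subsets of the real line\<close>

text \<open>
  Elements of Lebesgue and Sobolev spaces are represented by functions on all of the reals, of
  which only the values on \<open>S\<close> matter; two representatives that agree almost everywhere on \<open>S\<close>
  stand for the same element.
\<close>

definition lp_space :: "ereal \<Rightarrow> real set \<Rightarrow> (real \<Rightarrow> real) set" where
  "lp_space p S = {f \<in> borel_measurable (lebesgue_on S).
     if p = \<infinity> then \<exists>C. AE x in lebesgue_on S. \<bar>f x\<bar> \<le> C
     else integrable (lebesgue_on S) (\<lambda>x. \<bar>f x\<bar> powr real_of_ereal p)}"

definition locally_integrable :: "real set \<Rightarrow> (real \<Rightarrow> real) \<Rightarrow> bool" where
  "locally_integrable S f \<longleftrightarrow> (\<forall>K. compact K \<and> K \<subseteq> S \<longrightarrow> integrable (lebesgue_on K) f)"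

definition smooth :: "(real \<Rightarrow> real) \<Rightarrow> bool" where
  "smooth \<phi> \<longleftrightarrow> (\<forall>n x. (deriv ^^ n) \<phi> field_differentiable at x)"

definition test_functions :: "real set \<Rightarrow> (real \<Rightarrow> real) set" where
  "test_functions S = {\<phi>. smooth \<phi> \<and> compact (closure {x. \<phi> x \<noteq> 0}) \<and> closure {x. \<phi> x \<noteq> 0} \<subseteq> S}"

definition has_weak_deriv :: "real set \<Rightarrow> (real \<Rightarrow> real) \<Rightarrow> (real \<Rightarrow> real) \<Rightarrow> bool" where
  "has_weak_deriv S u g \<longleftrightarrow> locally_integrable S u \<and> locally_integrable S g \<and>
     (\<forall>\<phi>\<in>test_functions S.
        (\<integral>x. u x * deriv \<phi> x \<partial>lebesgue_on S) = - (\<integral>x. g x * \<phi> x \<partial>lebesgue_on S))"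

text \<open>The weak derivative is unique up to null sets; this picks a representative.\<close>

definition weak_deriv :: "real set \<Rightarrow> (real \<Rightarrow> real) \<Rightarrow> real \<Rightarrow> real" where
  "weak_deriv S u = (SOME g. has_weak_deriv S u g)"

definition sobolev1 :: "ereal \<Rightarrow> real set \<Rightarrow> (real \<Rightarrow> real) set" where
  "sobolev1 p S = {u \<in> lp_space p S. \<exists>g\<in>lp_space p S. has_weak_deriv S u g}"

section \<open>Finite signed measures\<close>

definition signed_measure :: "'a measure \<Rightarrow> ('a set \<Rightarrow> real) \<Rightarrow> bool" where
  "signed_measure M \<mu> \<longleftrightarrow> \<mu> {} = 0 \<and>
     (\<forall>A. range A \<subseteq> sets M \<longrightarrow> disjoint_family A \<longrightarrow> (\<lambda>n::nat. \<mu> (A n)) sums \<mu> (\<Union>n. A n))"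

text \<open>
  The positive part of the Jordan decomposition, given on a measurable \<open>A\<close> by the supremum of
  \<open>\<mu> B\<close> over measurable \<open>B \<subseteq> A\<close>. The truncation of negative values by \<^const>\<open>ennreal\<close> does not
  affect the supremum, since \<open>B = {}\<close> is admitted. The negative part of \<open>\<mu>\<close> is the positive
  part of \<open>- \<mu>\<close>.
\<close>

definition pos_variation :: "'a measure \<Rightarrow> ('a set \<Rightarrow> real) \<Rightarrow> 'a measure" where
  "pos_variation M \<mu> =
     measure_of (space M) (sets M) (\<lambda>A. SUP B\<in>{B \<in> sets M. B \<subseteq> A}. ennreal (\<mu> B))"

definition signed_integral :: "'a measure \<Rightarrow> ('a set \<Rightarrow> real) \<Rightarrow> ('a \<Rightarrow> real) \<Rightarrow> real" where
  "signed_integral M \<mu> f =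
     (\<integral>w. f w \<partial>pos_variation M \<mu>) - (\<integral>w. f w \<partial>pos_variation M (\<lambda>A. - \<mu> A))"

section \<open>Barron functions of one variable\<close>

definition relu :: "real \<Rightarrow> real" where
  "relu z = max z 0"

definition circle_borel :: "(real \<times> real) measure" where
  "circle_borel = restrict_space borel (sphere 0 1)"

definition barron_space :: "(real \<Rightarrow> real) set" where
  "barron_space = {f. \<exists>\<mu>. signed_measure circle_borel \<mu> \<and>
     (\<forall>x. f x = signed_integral circle_borel \<mu> (\<lambda>w. relu (w \<bullet> (x, 1))))}"

section \<open>The functional\<close>

text \<open>
  The integrand is nonnegative on the unit interval, so the coercion \<^const>\<open>ennreal\<close> does not
  truncate. Only the restriction of \<open>u\<close> to \<open>(0,1)\<close> enters.
\<close>

definition J :: "(real \<Rightarrow> real) \<Rightarrow> ennreal" where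
  "J u = (\<integral>\<^sup>+x. ennreal
      ((u x)\<^sup>2 * (u x - x)\<^sup>2 / x ^ 5
       + ((weak_deriv {0<..<1} u x)\<^sup>2 - 1)\<^sup>2 / x
       + (u x)\<^sup>2) \<partial>lebesgue_on {0<..<1})"

end

theory Submission
  imports Defs
begin

text \<open>
  In the Sobolev spaces the infimum vanishes along \<open>u = x\<^sup>2 arcsin (sin (N / x)) / N\<close>, whose zigzags
  accumulate at the origin: \<open>u\<close> is of size \<open>x\<^sup>2 / N\<close> and \<open>u'\<close> is \<open>\<plusminus>1\<close> up to an error of size \<open>x / N\<close>,
  so the integrand is of size \<open>1 / N\<^sup>2\<close>.

  The derivative \<open>g\<close> of a Barron function \<open>u\<close> has a limit \<open>L\<close> at \<open>0+\<close>. If \<open>J u\<close> is finite, the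
  singular weights force \<open>u 0 = 0\<close> and \<open>L\<^sup>2 (L - 1)\<^sup>2 + (L\<^sup>2 - 1)\<^sup>2 = 0\<close>, hence \<open>L = 1\<close>, and
  \<open>v = u / x\<close> tends to \<open>1\<close>. Either \<open>v\<close> stays above \<open>1/4\<close>, so that the term \<open>u\<^sup>2\<close> is bounded below,
  or \<open>v\<close> descends from \<open>3/4\<close> to \<open>1/4\<close>. The descent has a scale-invariant cost: there
  \<open>- v' = (v - g) / x\<close> is at most \<open>72\<close> times the integrand, while it integrates to at least \<open>1/2\<close>.
\<close>

section \<open>Smooth cutoff functions\<close>

text \<open>All iterates of \<open>deriv\<close> stay inside a class \<open>P\<close> of
  differentiable functions that is invariant under \<open>deriv\<close>. This avoids explicit
  formulas for higher derivatives.\<close>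

lemma smoothI_closed:
  assumes "P f" and d: "\<And>f x. P f \<Longrightarrow> f field_differentiable at x" and "\<And>f. P f \<Longrightarrow> P (deriv f)"
  shows "smooth f"
proof -
  have "P ((deriv ^^ n) f)" for n
    by (induction n) (use assms in auto)
  then show ?thesis
    using d by (auto simp: smooth_def)
qed

lemma smooth_deriv: "smooth f \<Longrightarrow> smooth (deriv f)"
  unfolding smooth_def by (metis comp_apply funpow_Suc_right)

lemma smooth_DERIV: "smooth f \<Longrightarrow> (f has_real_derivative deriv f x) (at x)"
  unfolding smooth_def by (metis funpow_0 field_differentiable_derivI)

lemma smooth_continuous_on: "smooth f \<Longrightarrow> continuous_on S f"
  by (meson smooth_DERIV DERIV_isCont continuous_at_imp_continuous_on)

text \<open>
  A class that contains all products of smooth functions and is closed under \<^const>\<open>deriv\<close>: this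
  replaces the Leibniz formula for higher derivatives.
\<close>

inductive product_sum :: "(real \<Rightarrow> real) \<Rightarrow> bool" where
  "smooth f \<Longrightarrow> smooth g \<Longrightarrow> product_sum (\<lambda>x. f x * g x)"
| "product_sum f \<Longrightarrow> product_sum g \<Longrightarrow> product_sum (\<lambda>x. f x + g x)"

lemma smooth_mult:
  assumes "smooth f" "smooth g"
  shows "smooth (\<lambda>x. f x * g x)"
proof (rule smoothI_closed)
  show "product_sum (\<lambda>x. f x * g x)"
    using assms by (rule product_sum.intros)
  have *: "(\<forall>x. h field_differentiable at x) \<and> product_sum (deriv h)" if "product_sum h" for h
    using that
  proof induction
    case (1 f g)
    have D: "((\<lambda>x. f x * g x) has_real_derivative deriv f x * g x + f x * deriv g x) (at x)" for x
      using 1 by (auto intro!: derivative_eq_intros smooth_DERIV)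
    then have "deriv (\<lambda>x. f x * g x) = (\<lambda>x. deriv f x * g x + f x * deriv g x)"
      by (auto intro: DERIV_imp_deriv)
    moreover have "product_sum \<dots>"
      using 1 by (intro product_sum.intros smooth_deriv)
    ultimately show ?case
      using D field_differentiable_def by metis
  next
    case (2 f g)
    then have "deriv (\<lambda>x. f x + g x) = (\<lambda>x. deriv f x + deriv g x)"
      by (auto intro: deriv_add)
    moreover have "product_sum \<dots>"
      using 2 by (intro product_sum.intros) auto
    ultimately show ?case
      using 2 by (auto intro: field_differentiable_add)
  qed
  then show "\<And>h x. product_sum h \<Longrightarrow> h field_differentiable at x"
    and "\<And>h. product_sum h \<Longrightarrow> product_sum (deriv h)" by auto
qed

lemma smooth_affine:
  assumes "smooth f"
  shows "smooth (\<lambda>x. f (c * x + d))"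
\<comment> \<open>Each differentiation brings out a factor \<open>c\<close>, so the invariant class
  admits scalar multiples \<open>k\<close>.\<close>
proof (rule smoothI_closed[where P = "\<lambda>h. \<exists>p k. smooth p \<and> h = (\<lambda>x. k * p (c * x + d))"])
  show "\<exists>p k. smooth p \<and> (\<lambda>x. f (c * x + d)) = (\<lambda>x. k * p (c * x + d))"
    using assms by (intro exI[of _ f] exI[of _ 1]) auto
  have D: "((\<lambda>x. k * p (c * x + d)) has_real_derivative (k * c) * deriv p (c * x + d)) (at x)"
    if "smooth p" for p k x
    by (rule derivative_eq_intros DERIV_chain'[OF _ smooth_DERIV[OF that]] refl | simp)+
  fix h assume "\<exists>p k. smooth p \<and> h = (\<lambda>x. k * p (c * x + d))"
  then obtain p k where p: "smooth p" and h: "h = (\<lambda>x. k * p (c * x + d))" by auto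
  show "h field_differentiable at x" for x
    using D[OF p] unfolding h field_differentiable_def by blast
  have "deriv h = (\<lambda>x. (k * c) * deriv p (c * x + d))"
    unfolding h using D[OF p] by (auto intro: DERIV_imp_deriv)
  then show "\<exists>p k. smooth p \<and> deriv h = (\<lambda>x. k * p (c * x + d))"
    using smooth_deriv[OF p] by blast
qed

text \<open>For \<open>p = 1\<close> this is the classical function exp (-1/x), extended by 0 to x
  \<le> 0, which is smooth but not analytic at 0. The polynomial factor in 1/x makes the family
  closed under differentiation.\<close>

definition flat :: "real poly \<Rightarrow> real \<Rightarrow> real" where
  "flat p x = (if x > 0 then poly p (inverse x) * exp (- inverse x) else 0)"

lemma poly_exp_tendsto_0: "((\<lambda>y. poly p y * exp (- y)) \<longlongrightarrow> 0) (at_top :: real filter)"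
proof -
  have "((\<lambda>y::real. \<Sum>i\<le>degree p. coeff p i * (y ^ i / exp y)) \<longlongrightarrow> (\<Sum>i\<le>degree p. coeff p i * 0)) at_top"
    by (intro tendsto_intros tendsto_power_div_exp_0)
  then show ?thesis
    by (simp add: poly_altdef exp_minus sum_distrib_right sum_divide_distrib field_simps)
qed

text \<open>With y = 1/x one has d/dx = - y^2 d/dy, and p(y) exp (-y) has the y-derivative (p' -
  p)(y) exp (-y). This explains the polynomial y^2 (p - p').\<close>

lemma flat_DERIV: "(flat p has_real_derivative flat ([:0, 0, 1:] * (p - pderiv p)) x) (at x)"
proof -
  consider "x > 0" | "x < 0" | "x = 0" by linarith
  then show ?thesis
  proof cases
    case 1
    have "((\<lambda>x. poly p (inverse x) * exp (- inverse x)) has_real_derivative flat ([:0, 0, 1:] * (p - pderiv p)) x) (at x)"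
      using 1 unfolding flat_def
      by (auto intro!: derivative_eq_intros DERIV_chain'[OF _ poly_DERIV] simp: power2_eq_square algebra_simps)
    then show ?thesis
      by (rule has_field_derivative_transform_within_open[of _ _ _ "{0<..}"]) (use 1 in \<open>auto simp: flat_def\<close>)
  next
    case 2
    have "((\<lambda>x. 0) has_real_derivative flat ([:0, 0, 1:] * (p - pderiv p)) x) (at x)"
      using 2 by (auto simp: flat_def)
    then show ?thesis
      by (rule has_field_derivative_transform_within_open[of _ _ _ "{..<0}"]) (use 2 in \<open>auto simp: flat_def\<close>)
  next
    case 3
    \<comment> \<open>The right difference quotient at 0 is y p(y) exp (-y) with y = 1/h, and the
      exponential wins as y tends to infinity. The left quotient is identically 0.\<close>
    have "((\<lambda>h. poly ([:0, 1:] * p) (inverse h) * exp (- inverse h)) \<longlongrightarrow> 0) (at_right (0::real))"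
      by (rule filterlim_compose[OF poly_exp_tendsto_0 filterlim_inverse_at_top_right])
    then have "((\<lambda>h. (flat p (0 + h) - flat p 0) / h) \<longlongrightarrow> 0) (at_right 0)"
      by (rule Lim_transform_eventually)
        (auto simp: flat_def divide_inverse eventually_at_right_field intro!: exI[of _ 1])
    moreover have "((\<lambda>h. (flat p (0 + h) - flat p 0) / h) \<longlongrightarrow> 0) (at_left 0)"
      by (rule tendsto_eventually) (auto simp: flat_def eventually_at_left_field intro!: exI[of _ "-1"])
    ultimately have "((\<lambda>h. (flat p (0 + h) - flat p 0) / h) \<longlongrightarrow> 0) (at 0)"
      by (simp add: filterlim_split_at)
    then show ?thesis
      using 3 by (simp add: DERIV_def) (simp add: flat_def)
  qed
qed

lemma smooth_flat: "smooth (flat p)"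
proof (rule smoothI_closed[where P = "\<lambda>h. \<exists>p. h = flat p"])
  show "\<And>h x. \<exists>p. h = flat p \<Longrightarrow> h field_differentiable at x"
    using flat_DERIV field_differentiable_def by blast
  show "\<And>h. \<exists>p. h = flat p \<Longrightarrow> \<exists>p. deriv h = flat p"
    using flat_DERIV DERIV_imp_deriv by (metis ext)
qed auto

text \<open>The product of a flat step that switches on at \<open>a\<close> and one that switches
  off at \<open>b\<close>, both steepened by the factor n + 1. Pointwise convergence holds because
  exp (-1/((n+1) y)) tends to 1 for y > 0.\<close>

lemma smooth_approx_indicator:
  fixes a b :: real
  obtains \<phi> :: "nat \<Rightarrow> real \<Rightarrow> real" where
    "\<And>n. smooth (\<phi> n)" "\<And>n x. \<phi> n x \<noteq> 0 \<Longrightarrow> x \<in> {a<..<b}" "\<And>n x. \<bar>\<phi> n x\<bar> \<le> 1"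
    "\<And>x. (\<lambda>n. \<phi> n x) \<longlonglongrightarrow> indicator {a<..<b} x"
proof -
  define h where "h = flat 1"
  have sm: "smooth h" unfolding h_def by (rule smooth_flat)
  have h01: "0 \<le> h x" "h x \<le> 1" for x
    by (auto simp: h_def flat_def)
  define \<phi> where "\<phi> n x = h (real (Suc n) * (x - a)) * h (real (Suc n) * (b - x))" for n x
  show ?thesis
  proof
    fix n x
    have "smooth (\<lambda>x. h (real (Suc n) * x + (- real (Suc n) * a)) * h (- real (Suc n) * x + (real (Suc n) * b)))"
      by (intro smooth_mult smooth_affine sm)
    then show "smooth (\<phi> n)"
      by (simp add: \<phi>_def[abs_def] algebra_simps)
    show "\<bar>\<phi> n x\<bar> \<le> 1"
      using mult_mono[OF h01(2) h01(2)] h01(1) by (auto simp: \<phi>_def abs_mult)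
    show "x \<in> {a<..<b}" if "\<phi> n x \<noteq> 0"
      using that by (auto simp: \<phi>_def h_def flat_def zero_less_mult_iff split: if_splits)
  next
    fix x
    have lim: "(\<lambda>n. h (real (Suc n) * y)) \<longlonglongrightarrow> (if y > 0 then 1 else 0)" for y
    proof (cases "y > 0")
      case True
      have "(\<lambda>n. exp (- (inverse (real (Suc n)) * inverse y))) \<longlonglongrightarrow> exp (- (0 * inverse y))"
        by (intro tendsto_intros LIMSEQ_inverse_real_of_nat)
      then show ?thesis
        using True by (simp add: h_def flat_def zero_less_mult_iff)
    qed (auto simp: h_def flat_def zero_less_mult_iff)
    have "(\<lambda>n. \<phi> n x) \<longlonglongrightarrow> (if x - a > 0 then 1 else 0) * (if b - x > 0 then 1 else 0)"
      unfolding \<phi>_def by (intro tendsto_mult lim)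
    then show "(\<lambda>n. \<phi> n x) \<longlonglongrightarrow> indicator {a<..<b} x"
      by (auto simp: indicator_def split: if_splits)
  qed
qed

section \<open>Weak derivatives on the unit interval\<close>

text \<open>Half-lines determine a finite Borel measure, so the measures whose densities are the
  positive and the negative part of \<open>f\<close> coincide, and these parts agree almost
  everywhere. A Borel version \<open>g\<close> replaces the Lebesgue measurable \<open>f\<close> in
  order to work over \<open>lborel\<close>.\<close>

lemma AE_zero_if_halfline_integrals_zero:
  fixes f :: "real \<Rightarrow> real"
  assumes f: "integrable lebesgue f"
    and 0: "\<And>a. (LINT x|lebesgue. indicator {a<..} x * f x) = 0"
  shows "AE x in lebesgue. f x = 0"
proof -
  obtain g where g[measurable]: "g \<in> borel_measurable lborel" and fg: "AE x in lborel. f x = g x"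
    using completion_ex_borel_measurable_real[OF borel_measurable_integrable[OF f]] by auto
  have gl: "g \<in> borel_measurable lebesgue"
    using g by (rule measurable_completion)
  have fg': "AE x in lebesgue. f x = g x"
    using fg by (rule AE_completion)
  have "integrable lebesgue g"
    by (rule integrable_cong_AE_imp[OF f gl]) (use fg' in \<open>eventually_elim, simp\<close>)
  then have g_int: "integrable lborel g"
    using g by (simp add: integrable_completion)
  have g0: "(LINT x|lborel. indicator {a<..} x * g x) = 0" for a
  proof -
    have "(LINT x|lborel. indicator {a<..} x * g x) = (LINT x|lebesgue. indicator {a<..} x * g x)"
      by (rule integral_completion[symmetric]) measurable
    also have "\<dots> = (LINT x|lebesgue. indicator {a<..} x * f x)"
    proof (intro integral_cong_AE borel_measurable_times gl borel_measurable_integrable[OF f])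
      show "(indicator {a<..} :: real \<Rightarrow> real) \<in> borel_measurable lebesgue"
        by (intro measurable_completion) simp
      then show "(indicator {a<..} :: real \<Rightarrow> real) \<in> borel_measurable lebesgue" .
      show "AE x in lebesgue. indicator {a<..} x * g x = indicator {a<..} x * f x"
        using fg' by eventually_elim simp
    qed
    finally show ?thesis using 0 by simp
  qed
  \<comment> \<open>\<open>ennreal\<close> truncates at 0, so the two densities are the positive and
    the negative part of \<open>g\<close>.\<close>
  let ?M = "density lborel (\<lambda>x. ennreal (g x))" and ?N = "density lborel (\<lambda>x. ennreal (- g x))"
  have enn2real_inj: "x = y" if "enn2real x = enn2real y" "x \<noteq> \<infinity>" "y \<noteq> \<infinity>" for x y
    using that by (metis ennreal_enn2real infinity_ennreal_def top.not_eq_extremum)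
  have "?M = ?N"
  proof (rule measure_eqI_lessThan)
    fix a
    have int: "integrable lborel (\<lambda>x. indicator {a<..} x * g x)"
      using integrable_mult_indicator[OF _ g_int, of "{a<..}"] by simp
    have M: "emeasure ?M {a<..} = (\<integral>\<^sup>+x. ennreal (indicator {a<..} x * g x) \<partial>lborel)"
      by (subst emeasure_density) (auto intro!: nn_integral_cong split: split_indicator)
    have N: "emeasure ?N {a<..} = (\<integral>\<^sup>+x. ennreal (- (indicator {a<..} x * g x)) \<partial>lborel)"
      by (subst emeasure_density) (auto intro!: nn_integral_cong split: split_indicator)
    note fin = real_integrable_def[THEN iffD1, OF int]
    show "emeasure ?M {a<..} < \<infinity>"
      unfolding M using fin by (simp add: less_top[symmetric])
    have "enn2real (emeasure ?M {a<..}) = enn2real (emeasure ?N {a<..})"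
      unfolding M N using g0[of a] real_lebesgue_integral_def[OF int] by simp
    then show "emeasure ?M {a<..} = emeasure ?N {a<..}"
      using fin unfolding M N by (intro enn2real_inj) auto
  qed auto
  then have "AE x in lborel. ennreal (g x) = ennreal (- g x)"
    by (intro sigma_finite_measure.density_unique) (auto intro: lborel.sigma_finite_measure_axioms)
  then have "AE x in lborel. f x = 0"
    using fg
  proof eventually_elim
    case (elim x)
    then show ?case
      by (cases "g x \<ge> 0") (auto simp: ennreal_neg ennreal_eq_0_iff)
  qed
  then show ?thesis
    by (rule AE_completion)
qed

lemma test_functionsI:
  assumes "smooth \<phi>" "\<And>x. \<phi> x \<noteq> 0 \<Longrightarrow> x \<in> {a..b}" "{a..b} \<subseteq> S"
  shows "\<phi> \<in> test_functions S"
proof -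
  have "closure {x. \<phi> x \<noteq> 0} \<subseteq> {a..b}"
    using assms(2) by (intro closure_minimal) auto
  moreover from this have "compact (closure {x. \<phi> x \<noteq> 0})"
    by (meson bounded_closed_interval bounded_subset closed_closure compact_eq_bounded_closed)
  ultimately show ?thesis
    using assms unfolding test_functions_def by blast
qed


lemma has_weak_deriv_integrable:
  assumes "has_weak_deriv {0<..<1} u g" "0 < a" "b < 1"
  shows "integrable (lebesgue_on {a..b}) g"
proof -
  have "compact {a..b}" "{a..b} \<subseteq> {0<..<1}"
    using assms by auto
  then show ?thesis
    using assms(1) unfolding has_weak_deriv_def locally_integrable_def by blast
qed

text \<open>The fundamental lemma of the calculus of variations. The difference \<open>d\<close>
  integrates to 0 against every test function, hence by dominated convergence over every interval
  whose closure lies in (0,1), and so it vanishes almost everywhere.\<close>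

lemma has_weak_deriv_unique:
  assumes "has_weak_deriv {0<..<1} u g" "has_weak_deriv {0<..<1} u h"
  shows "AE x in lebesgue_on {0<..<1}. g x = h x"
proof -
  define d where "d x = g x - h x" for x
  have d_int: "integrable (lebesgue_on {a..b}) d" if "0 < a" "b < 1" for a b
    unfolding d_def using assms that
    by (intro Bochner_Integration.integrable_diff has_weak_deriv_integrable)
  have set_int: "integrable lebesgue (\<lambda>x. indicator {a<..<b} x * d x)" if "0 < a" "b < 1" for a b
  proof -
    have "integrable lebesgue (\<lambda>x. indicator {a..b} x *\<^sub>R d x)"
      using d_int[OF that] by (simp add: integrable_restrict_space)
    from integrable_mult_indicator[OF _ this, of "{a<..<b}"] show ?thesis
      by (rule back_subst[of "integrable _"]) (auto simp: indicator_def)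
  qed
  have zero: "(LINT x|lebesgue. indicator {a<..<b} x * d x) = 0" if ab: "0 < a" "b < 1" for a b
  proof -
    obtain \<phi> :: "nat \<Rightarrow> real \<Rightarrow> real" where \<phi>: "\<And>n. smooth (\<phi> n)" 
      "\<And>n x. \<phi> n x \<noteq> 0 \<Longrightarrow> x \<in> {a<..<b}" "\<And>n x. \<bar>\<phi> n x\<bar> \<le> 1"
      "\<And>x. (\<lambda>n. \<phi> n x) \<longlonglongrightarrow> indicator {a<..<b} x"
      using smooth_approx_indicator[of a b] by blast
    have test: "\<phi> n \<in> test_functions {0<..<1}" for n
      using \<phi>(1,2)[of n] ab by (intro test_functionsI[of _ a b]) fastforce+
    have \<phi>_meas: "\<phi> n \<in> borel_measurable lebesgue" for n
      using smooth_continuous_on[OF \<phi>(1)]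
      by (intro measurable_completion) (simp add: borel_measurable_continuous_onI)
    have prod_int: "integrable lebesgue (\<lambda>x. f x * \<phi> n x)"
      if "has_weak_deriv {0<..<1} u f" for f n
    proof -
      have "integrable (lebesgue_on {a..b}) f"
        using that ab by (rule has_weak_deriv_integrable)
      then have "integrable lebesgue (\<lambda>x. indicator {a..b} x *\<^sub>R f x)"
        by (simp add: integrable_restrict_space)
      then show ?thesis
      proof (rule Bochner_Integration.integrable_bound)
        show "AE x in lebesgue. norm (f x * \<phi> n x) \<le> norm (indicator {a..b} x *\<^sub>R f x)"
        proof (rule AE_I2)
          fix x
          show "norm (f x * \<phi> n x) \<le> norm (indicator {a..b} x *\<^sub>R f x)"
            using \<phi>(2)[of n x] \<phi>(3)[of n x] mult_left_mono[of "\<bar>\<phi> n x\<bar>" 1 "\<bar>f x\<bar>"]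
            by (cases "\<phi> n x = 0") (auto simp: abs_mult)
        qed
        have "(\<lambda>x. (indicator {a..b} x *\<^sub>R f x) * \<phi> n x) \<in> borel_measurable lebesgue"
          using \<open>integrable lebesgue (\<lambda>x. indicator {a..b} x *\<^sub>R f x)\<close> \<phi>_meas
          by (intro borel_measurable_times) auto
        moreover have "(\<lambda>x. (indicator {a..b} x *\<^sub>R f x) * \<phi> n x) = (\<lambda>x. f x * \<phi> n x)"
          using \<phi>(2)[of n] by (fastforce simp: indicator_def)
        ultimately show "(\<lambda>x. f x * \<phi> n x) \<in> borel_measurable lebesgue" by simp
      qed
    qed
    have restr: "(LINT x|lebesgue_on {0<..<1}. f x * \<phi> n x) = (LINT x|lebesgue. f x * \<phi> n x)" for f n
    proof -
      have "(\<lambda>x. indicator {0<..<1} x *\<^sub>R (f x * \<phi> n x)) = (\<lambda>x. f x * \<phi> n x)"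
        using \<phi>(2)[of n] ab by (fastforce simp: indicator_def)
      then show ?thesis
        by (simp add: integral_restrict_space)
    qed
    have "(LINT x|lebesgue. d x * \<phi> n x) = 0" for n
    proof -
      have "(LINT x|lebesgue. g x * \<phi> n x) = (LINT x|lebesgue. h x * \<phi> n x)"
        using assms test[of n] unfolding has_weak_deriv_def restr[symmetric] by force
      then show ?thesis
        using prod_int assms by (simp add: d_def left_diff_distrib)
    qed
    moreover have "(\<lambda>n. LINT x|lebesgue. d x * \<phi> n x) \<longlonglongrightarrow> (LINT x|lebesgue. indicator {a<..<b} x * d x)"
    proof (rule integral_dominated_convergence)
      show "integrable lebesgue (\<lambda>x. \<bar>indicator {a<..<b} x * d x\<bar>)"
        using set_int[OF ab] by auto
      show "AE x in lebesgue. (\<lambda>n. d x * \<phi> n x) \<longlonglongrightarrow> indicator {a<..<b} x * d x"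
        using tendsto_mult[OF tendsto_const \<phi>(4)] by (auto simp: mult.commute)
      show "AE x in lebesgue. norm (d x * \<phi> n x) \<le> \<bar>indicator {a<..<b} x * d x\<bar>" for n
      proof (rule AE_I2)
        fix x
        show "norm (d x * \<phi> n x) \<le> \<bar>indicator {a<..<b} x * d x\<bar>"
          using \<phi>(2)[of n x] \<phi>(3)[of n x] mult_left_mono[of "\<bar>\<phi> n x\<bar>" 1 "\<bar>d x\<bar>"]
          by (cases "\<phi> n x = 0") (auto simp: abs_mult)
      qed
      show "(\<lambda>x. d x * \<phi> n x) \<in> borel_measurable lebesgue" for n
        using prod_int assms by (auto simp: d_def left_diff_distrib)
      show "(\<lambda>x. indicator {a<..<b} x * d x) \<in> borel_measurable lebesgue"
        using set_int[OF ab] by auto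
    qed
    ultimately show ?thesis
      by (simp add: LIMSEQ_const_iff)
  qed
  \<comment> \<open>\<open>d\<close> is only known to be locally integrable, so the half-line
    criterion is applied to its truncations to intervals that exhaust (0,1).\<close>
  have "AE x in lebesgue. indicator {1 / (real n + 2)<..<1 - 1 / (real n + 2)} x * d x = 0" (is "AE x in _. indicator ?I x * _ = 0") for n
  proof (rule AE_zero_if_halfline_integrals_zero)
    show "integrable lebesgue (\<lambda>x. indicator ?I x * d x)"
      by (rule set_int) auto
    fix a
    have "indicator {a<..} x * (indicator ?I x * d x)
        = indicator {max a (1 / (real n + 2))<..<1 - 1 / (real n + 2)} x * d x" for x
      by (auto simp: indicator_def)
    then show "(LINT x|lebesgue. indicator {a<..} x * (indicator ?I x * d x)) = 0"
      by (simp only:) (simp add: zero less_max_iff_disj)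
  qed
  then have "AE x in lebesgue. \<forall>n. indicator {1 / (real n + 2)<..<1 - 1 / (real n + 2)} x * d x = 0"
    unfolding AE_all_countable by blast
  then have "AE x in lebesgue. x \<in> {0<..<1} \<longrightarrow> g x = h x"
  proof eventually_elim
    case (elim x)
    show ?case
    proof
      assume x: "x \<in> {0<..<1}"
      obtain n where "inverse (real (Suc n)) < min x (1 - x)"
        using reals_Archimedean[of "min x (1 - x)"] x by auto
      moreover have "1 / (real n + 2) \<le> inverse (real (Suc n))"
        by (simp add: field_simps)
      ultimately have "x \<in> {1 / (real n + 2)<..<1 - 1 / (real n + 2)}"
        by auto
      then show "g x = h x"
        using elim[rule_format, of n] by (simp add: d_def)
    qed
  qed
  then show ?thesis
    by (subst AE_restrict_space_iff) auto
qed

lemma integrable_bounded_borel: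
  fixes f :: "real \<Rightarrow> real"
  assumes "f \<in> borel_measurable borel" "\<And>x. x \<in> S \<Longrightarrow> \<bar>f x\<bar> \<le> C" "S \<in> lmeasurable"
  shows "integrable (lebesgue_on S) f"
proof -
  interpret finite_measure "lebesgue_on S"
    using assms(3) by (rule finite_measure_lebesgue_on)
  have "f \<in> borel_measurable lebesgue"
    using assms(1) by (intro measurable_completion) auto
  then show ?thesis
    using assms(2) by (intro integrable_const_bound[of _ C] measurable_restrict_space1) (auto intro!: AE_I2)
qed

text \<open>Classical integration by parts on compact subintervals suffices: on an interval that
  contains the support of the test function in its interior the boundary terms vanish. In this form
  the criterion covers functions with corners.\<close>

lemma has_weak_derivI:
  fixes u g :: "real \<Rightarrow> real"
  assumes u: "u \<in> borel_measurable borel" "\<And>x. x \<in> {0<..<1} \<Longrightarrow> \<bar>u x\<bar> \<le> C"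
    and g: "g \<in> borel_measurable borel" "\<And>x. x \<in> {0<..<1} \<Longrightarrow> \<bar>g x\<bar> \<le> C"
    and parts: "\<And>\<phi> a b. smooth \<phi> \<Longrightarrow> 0 < a \<Longrightarrow> a \<le> b \<Longrightarrow> b < 1 \<Longrightarrow>
      ((\<lambda>x. u x * deriv \<phi> x + g x * \<phi> x) has_integral u b * \<phi> b - u a * \<phi> a) {a..b}"
  shows "has_weak_deriv {0<..<1} u g"
  unfolding has_weak_deriv_def locally_integrable_def
proof (intro conjI allI ballI impI)
  fix K :: "real set" assume "compact K \<and> K \<subseteq> {0<..<1}"
  then show "integrable (lebesgue_on K) u" "integrable (lebesgue_on K) g"
    using u g by (auto intro!: integrable_bounded_borel[of _ _ C] lmeasurable_compact)
next
  fix \<phi> assume \<phi>: "\<phi> \<in> test_functions {0<..<1}"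
  \<comment> \<open>The point 1/2 keeps \<open>K\<close> nonempty when \<phi> = 0, so that minimum
    and maximum exist.\<close>
  define K where "K = insert (1/2) (closure {x. \<phi> x \<noteq> 0})"
  have K: "compact K" "K \<subseteq> {0<..<1}" "K \<noteq> {}" and sm: "smooth \<phi>"
    using \<phi> by (auto simp: K_def test_functions_def)
  obtain s t where s: "s \<in> K" "\<And>x. x \<in> K \<Longrightarrow> s \<le> x" and t: "t \<in> K" "\<And>x. x \<in> K \<Longrightarrow> x \<le> t"
    using compact_attains_inf[OF K(1,3)] compact_attains_sup[OF K(1,3)] by blast
  \<comment> \<open>These points lie strictly between the support and the ends of (0,1), so \<phi>
    is 0 at both.\<close>
  define a b where "a = s / 2" and "b = (t + 1) / 2"
  have ab: "0 < a" "a < s" "s \<le> t" "t < b" "b < 1"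
    using s t K(2) by (auto simp: a_def b_def)
  have out: "\<phi> x = 0" if "x \<notin> {s..t}" for x
  proof (rule ccontr)
    assume "\<phi> x \<noteq> 0"
    then have "x \<in> K" unfolding K_def by (intro insertI2 subsetD[OF closure_subset]) simp
    then show False using that s(2) t(2) by simp
  qed
  have out': "deriv \<phi> x = 0" if "x \<notin> {s..t}" for x
  proof -
    have "(\<phi> has_real_derivative 0) (at x)"
      by (rule has_field_derivative_transform_within_open[of "\<lambda>_. 0" _ _ "- {s..t}"])
        (use that out in auto)
    then show ?thesis by (rule DERIV_imp_deriv)
  qed
  obtain B where B: "\<And>x. \<bar>\<phi> x\<bar> \<le> B" "\<And>x. \<bar>deriv \<phi> x\<bar> \<le> B"
  proof -
    have "bounded (\<phi> ` {s..t})" "bounded (deriv \<phi> ` {s..t})"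
      using sm by (auto intro!: compact_imp_bounded compact_continuous_image smooth_continuous_on smooth_deriv)
    then obtain B1 B2 where B1: "\<And>x. x \<in> {s..t} \<Longrightarrow> \<bar>\<phi> x\<bar> \<le> B1"
      and B2: "\<And>x. x \<in> {s..t} \<Longrightarrow> \<bar>deriv \<phi> x\<bar> \<le> B2"
      unfolding bounded_iff real_norm_def by blast
    have "\<bar>\<phi> x\<bar> \<le> \<bar>B1\<bar> + \<bar>B2\<bar>" "\<bar>deriv \<phi> x\<bar> \<le> \<bar>B1\<bar> + \<bar>B2\<bar>" for x
      using out[of x] out'[of x] B1[of x] B2[of x] by (cases "x \<in> {s..t}"; simp)+
    then show ?thesis using that by blast
  qed
  have m: "\<phi> \<in> borel_measurable borel" "deriv \<phi> \<in> borel_measurable borel"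
    using sm by (auto intro!: borel_measurable_continuous_onI smooth_continuous_on smooth_deriv)
  have i1: "integrable (lebesgue_on {0<..<1}) (\<lambda>x. u x * deriv \<phi> x)"
    and i2: "integrable (lebesgue_on {0<..<1}) (\<lambda>x. g x * \<phi> x)"
    by (intro integrable_bounded_borel[of _ _ "C * B"] borel_measurable_times u g m,
        simp add: abs_mult mult_mono' u g B, simp)+
  have "((\<lambda>x. u x * deriv \<phi> x + g x * \<phi> x) has_integral 0) {a..b}"
    using parts[OF sm, of a b] ab out[of a] out[of b] by auto
  then have "((\<lambda>x. u x * deriv \<phi> x + g x * \<phi> x) has_integral 0) {0<..<1}"
    by (rule has_integral_on_superset) (use ab out out' in auto)
  moreover have "((\<lambda>x. u x * deriv \<phi> x + g x * \<phi> x) has_integral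
      (LINT x|lebesgue_on {0<..<1}. u x * deriv \<phi> x + g x * \<phi> x)) {0<..<1}"
    using i1 i2 by (intro has_integral_integral_lebesgue_on) auto
  ultimately have "(LINT x|lebesgue_on {0<..<1}. u x * deriv \<phi> x + g x * \<phi> x) = 0"
    using has_integral_unique by blast
  then show "(LINT x|lebesgue_on {0<..<1}. u x * deriv \<phi> x) = - (LINT x|lebesgue_on {0<..<1}. g x * \<phi> x)"
    using i1 i2 by simp
qed

text \<open>\<open>weak_deriv\<close> is a mere choice; by uniqueness almost everywhere,
  \<open>J\<close> can be computed with any weak derivative at hand.\<close>

lemma J_eq:
  assumes "has_weak_deriv {0<..<1} u g"
  shows "J u = (\<integral>\<^sup>+x. ennreal ((u x)\<^sup>2 * (u x - x)\<^sup>2 / x ^ 5 + ((g x)\<^sup>2 - 1)\<^sup>2 / x + (u x)\<^sup>2)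
    \<partial>lebesgue_on {0<..<1})"
proof -
  have "has_weak_deriv {0<..<1} u (weak_deriv {0<..<1} u)"
    unfolding weak_deriv_def using assms by (rule someI[where P = "has_weak_deriv {0<..<1} u"])
  from has_weak_deriv_unique[OF this assms] show ?thesis
    unfolding J_def by (intro nn_integral_cong_AE) auto
qed

section \<open>Finite signed measures are bounded\<close>

lemma signed_measure_Un:
  assumes "signed_measure M \<mu>" "A \<in> sets M" "B \<in> sets M" "A \<inter> B = {}"
  shows "\<mu> (A \<union> B) = \<mu> A + \<mu> B"
proof -
  have "range (binaryset A B) \<subseteq> sets M" "disjoint_family (binaryset A B)"
    using assms by (auto simp: range_binaryset_eq disjoint_family_on_def binaryset_def)
  then have "(\<lambda>n. \<mu> (binaryset A B n)) sums \<mu> (A \<union> B)"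
    using assms(1) unfolding signed_measure_def UN_binaryset_eq[symmetric] by blast
  moreover have "(\<lambda>n. \<mu> (binaryset A B n)) sums (\<Sum>n\<in>{0, 1}. \<mu> (binaryset A B n))"
    using assms(1) by (intro sums_finite) (auto simp: binaryset_def signed_measure_def)
  ultimately show ?thesis
    by (auto simp: binaryset_def dest: sums_unique2)
qed

text \<open>If \<mu> is unbounded on the subsets of \<open>E\<close>, then \<open>E\<close> splits
  into two pieces of large measure, and \<mu> is still unbounded on one of them. Iterating this
  peels off disjoint sets with |\<mu>| > 1, which contradicts the convergence of the series that
  countable additivity provides.\<close>

lemma signed_measure_bounded:
  assumes \<mu>: "signed_measure M \<mu>"
  obtains C where "\<And>A. A \<in> sets M \<Longrightarrow> \<bar>\<mu> A\<bar> \<le> C"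
proof -
  define unb where "unb E \<longleftrightarrow> E \<in> sets M \<and> (\<forall>C. \<exists>B\<in>sets M. B \<subseteq> E \<and> \<bar>\<mu> B\<bar> > C)" for E
  have add: "\<mu> E = \<mu> B + \<mu> (E - B)" if "E \<in> sets M" "B \<in> sets M" "B \<subseteq> E" for E B
    using signed_measure_Un[OF \<mu>, of B "E - B"] that by (auto simp: Un_absorb1)
  have step: "\<exists>E'. unb E' \<and> E' \<subseteq> E \<and> \<bar>\<mu> (E - E')\<bar> > 1" if E: "unb E" for E
  proof -
    \<comment> \<open>The threshold makes both |\<mu> B| and |\<mu> (E - B)| \<ge> |\<mu> B| -
      |\<mu> E| exceed 1, so either piece may be the one removed.\<close>
    obtain B where B: "B \<in> sets M" "B \<subseteq> E" "\<bar>\<mu> B\<bar> > \<bar>\<mu> E\<bar> + 1"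
      using E unfolding unb_def by meson
    have EB: "E \<in> sets M" "\<mu> E = \<mu> B + \<mu> (E - B)"
      using add[of E B] B E by (auto simp: unb_def)
    show ?thesis
    proof (cases "unb B")
      case True
      then show ?thesis
        using B EB by (intro exI[of _ B]) auto
    next
      case False
      then obtain C where C: "\<And>A. A \<in> sets M \<Longrightarrow> A \<subseteq> B \<Longrightarrow> \<bar>\<mu> A\<bar> \<le> C"
        using B unfolding unb_def by (meson not_le)
      have "\<exists>A\<in>sets M. A \<subseteq> E - B \<and> \<bar>\<mu> A\<bar> > K" for K
      proof -
        obtain D where D: "D \<in> sets M" "D \<subseteq> E" "\<bar>\<mu> D\<bar> > K + C"
          using E unfolding unb_def by meson
        have "\<mu> D = \<mu> (D \<inter> B) + \<mu> (D - D \<inter> B)"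
          using D B by (intro add) auto
        moreover have "\<bar>\<mu> (D \<inter> B)\<bar> \<le> C"
          using D B by (intro C) auto
        ultimately have "\<bar>\<mu> (D - D \<inter> B)\<bar> > K"
          using D by linarith
        then show ?thesis
          using D B by (intro bexI[of _ "D - D \<inter> B"]) auto
      qed
      then have "unb (E - B)"
        using EB B by (auto simp: unb_def)
      moreover have "E - (E - B) = B"
        using B by auto
      ultimately show ?thesis
        using B by (intro exI[of _ "E - B"]) auto
    qed
  qed
  have "\<not> unb (space M)"
  proof
    assume "unb (space M)"
    then obtain E where E: "\<And>n. unb (E n)" "\<And>n. E (Suc n) \<subseteq> E n \<and> \<bar>\<mu> (E n - E (Suc n))\<bar> > 1"
    proof -
      obtain S where S: "\<And>E. unb E \<Longrightarrow> unb (S E) \<and> S E \<subseteq> E \<and> \<bar>\<mu> (E - S E)\<bar> > 1"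
        using step by metis
      have "unb ((S ^^ n) (space M))" for n
        by (induction n) (use \<open>unb (space M)\<close> S in auto)
      then show ?thesis
        using that[of "\<lambda>n. (S ^^ n) (space M)"] S by simp
    qed
    have mono: "E n \<subseteq> E m" if "m \<le> n" for m n
      by (rule lift_Suc_antimono_le[OF _ that]) (use E(2) in blast)
    define A where "A n = E n - E (Suc n)" for n
    have "A m \<inter> A n = {}" if "m < n" for m n
      using mono[of "Suc m" n] that by (auto simp: A_def)
    then have "A m \<inter> A n = {}" if "m \<noteq> n" for m n
      using that by (metis Int_commute linorder_neqE_nat)
    then have "disjoint_family A"
      by (simp add: disjoint_family_on_def)
    moreover have "range A \<subseteq> sets M"
      using E(1) by (auto simp: A_def unb_def)
    ultimately have "summable (\<lambda>n. \<mu> (A n))"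
      using \<mu> unfolding signed_measure_def by (blast intro: sums_summable)
    then have "(\<lambda>n. \<mu> (A n)) \<longlonglongrightarrow> 0"
      by (rule summable_LIMSEQ_zero)
    then obtain n where "\<bar>\<mu> (A n)\<bar> < 1"
      using LIMSEQ_D[of "\<lambda>n. \<mu> (A n)" 0 1] by auto
    then show False
      using E(2)[of n] by (simp add: A_def)
  qed
  then obtain C where "\<not> (\<exists>B\<in>sets M. B \<subseteq> space M \<and> \<bar>\<mu> B\<bar> > C)"
    unfolding unb_def by auto
  then show ?thesis
    using that[of C] sets.sets_into_space[of _ M] by (simp add: not_less)
qed

section \<open>Total mass of the Jordan parts\<close>

lemma sets_pos_variation [simp]: "sets (pos_variation M \<mu>) = sets M"
  by (simp add: pos_variation_def)

text \<open>
  Countable additivity of the set function is not needed here: if it failed,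
  \<^const>\<open>measure_of\<close> would return the null measure, which is finite as well.
\<close>

lemma finite_measure_pos_variation:
  assumes "signed_measure M \<mu>"
  shows "finite_measure (pos_variation M \<mu>)"
proof
  obtain C where C: "\<And>A. A \<in> sets M \<Longrightarrow> \<bar>\<mu> A\<bar> \<le> C"
    using assms signed_measure_bounded by blast
  have "emeasure (pos_variation M \<mu>) (space M) \<le> (SUP B\<in>{B \<in> sets M. B \<subseteq> space M}. ennreal (\<mu> B))"
    unfolding pos_variation_def by (subst emeasure_measure_of_conv) auto
  also have "\<dots> \<le> ennreal C"
    using C by (intro SUP_least ennreal_leI) (auto dest: abs_le_D1)
  also have "\<dots> < \<infinity>"
    by simp
  finally show "emeasure (pos_variation M \<mu>) (space (pos_variation M \<mu>)) \<noteq> \<infinity>"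
    by (simp add: pos_variation_def)
qed

lemma signed_measure_uminus:
  "signed_measure M \<mu> \<Longrightarrow> signed_measure M (\<lambda>A. - \<mu> A)"
  by (auto simp: signed_measure_def intro!: sums_minus)

section \<open>Barron functions\<close>

text \<open>One positive measure at a time: a Barron function is the difference of the potentials of
  the two Jordan parts of its measure.\<close>

locale finite_circle_measure = finite_measure N for N :: "(real \<times> real) measure" +
  assumes sets_N: "sets N = sets circle_borel"
begin

definition potential :: "real \<Rightarrow> real" where
  "potential x = (\<integral>w. relu (w \<bullet> (x, 1)) \<partial>N)"

text \<open>The x-derivative of the potential, obtained under the integral sign, with the value 0 at
  the kink of \<open>relu\<close>.\<close>

definition slope :: "real \<Rightarrow> real" where
  "slope x = (\<integral>w. fst w * indicator {0<..} (w \<bullet> (x, 1)) \<partial>N)"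

lemma space_N: "space N = sphere 0 1"
  using sets_eq_imp_space_eq[OF sets_N] by (simp add: circle_borel_def space_restrict_space)

lemma measurable_fst_N [measurable]: "fst \<in> borel_measurable N"
  and measurable_snd_N [measurable]: "snd \<in> borel_measurable N"
proof -
  have "(\<lambda>w. w) \<in> N \<rightarrow>\<^sub>M (borel \<Otimes>\<^sub>M borel)"
    unfolding measurable_cong_sets[OF sets_N refl] circle_borel_def borel_prod
    by (rule measurable_restrict_space1) simp
  from measurable_compose[OF this measurable_fst] measurable_compose[OF this measurable_snd]
  show "fst \<in> borel_measurable N" "snd \<in> borel_measurable N" by simp_all
qed

lemma abs_fst_le: "w \<in> space N \<Longrightarrow> \<bar>fst w\<bar> \<le> 1"
  and abs_snd_le: "w \<in> space N \<Longrightarrow> \<bar>snd w\<bar> \<le> 1"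
  using norm_fst_le[of "fst w" "snd w"] norm_snd_le[of "snd w" "fst w"] by (auto simp: space_N)

lemma inner_circle: "w \<bullet> (x, 1::real) = fst w * x + snd w"
  by (cases w) auto

section \<open>Bounds and integrability over the circle\<close>

lemma abs_relu_le: "w \<in> space N \<Longrightarrow> \<bar>relu (fst w * x + snd w)\<bar> \<le> \<bar>x\<bar> + 1"
  using abs_fst_le[of w] abs_snd_le[of w] mult_right_mono[of "\<bar>fst w\<bar>" 1 "\<bar>x\<bar>"]
  by (auto simp: relu_def abs_mult[symmetric])

lemma integrable_relu: "integrable N (\<lambda>w. relu (fst w * x + snd w))"
  using abs_relu_le by (intro integrable_const_bound[of _ "\<bar>x\<bar> + 1"]) (auto simp: relu_def)

lemma abs_slope_integrand_le: "w \<in> space N \<Longrightarrow> \<bar>fst w * indicator {0<..} (fst w * x + snd w)\<bar> \<le> 1"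
  using abs_fst_le[of w] by (auto simp: indicator_def)

lemma integrable_slope: "integrable N (\<lambda>w. fst w * indicator {0<..} (fst w * x + snd w))"
  using abs_slope_integrand_le by (intro integrable_const_bound[of _ 1]) auto

lemma abs_slope_le: "\<bar>slope x\<bar> \<le> measure N (space N)"
proof -
  have "\<bar>slope x\<bar> \<le> (\<integral>w. 1 \<partial>N)"
    unfolding slope_def inner_circle
    by (rule integral_abs_bound_integral[OF integrable_slope]) (auto simp: abs_slope_integrand_le)
  then show ?thesis by simp
qed

lemma potential_lipschitz: "\<bar>potential x - potential y\<bar> \<le> measure N (space N) * \<bar>x - y\<bar>"
proof -
  have *: "\<bar>relu (fst w * x + snd w) - relu (fst w * y + snd w)\<bar> \<le> \<bar>x - y\<bar>" if "w \<in> space N" for w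
  proof -
    have "\<bar>relu (fst w * x + snd w) - relu (fst w * y + snd w)\<bar> \<le> \<bar>fst w * (x - y)\<bar>"
      by (auto simp: relu_def algebra_simps)
    also have "\<dots> \<le> 1 * \<bar>x - y\<bar>"
      unfolding abs_mult by (intro mult_right_mono abs_fst_le that) auto
    finally show ?thesis by simp
  qed
  have "potential x - potential y = (\<integral>w. relu (fst w * x + snd w) - relu (fst w * y + snd w) \<partial>N)"
    unfolding potential_def inner_circle by (simp add: integrable_relu)
  also have "\<bar>\<dots>\<bar> \<le> (\<integral>w. \<bar>x - y\<bar> \<partial>N)"
    by (rule integral_abs_bound_integral) (auto simp: integrable_relu *)
  finally show ?thesis by (simp add: mult.commute)
qed

lemma measurable_slope: "slope \<in> borel_measurable borel"
proof -
  have "(\<lambda>p. fst (snd p)) \<in> borel_measurable (borel \<Otimes>\<^sub>M N)" "(\<lambda>p. snd (snd p)) \<in> borel_measurable (borel \<Otimes>\<^sub>M N)"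
    by (rule measurable_compose[OF measurable_snd]; simp)+
  note [measurable] = this
  have "(\<lambda>x. \<integral>w. fst w * indicator {0<..} (fst w * x + snd w) \<partial>N) \<in> borel_measurable borel"
    by (rule borel_measurable_lebesgue_integral) (simp add: case_prod_beta)
  then show ?thesis
    by (simp add: slope_def[abs_def] inner_circle)
qed

text \<open>For fixed \<open>w\<close> the sign of \<open>fst w * x + snd w\<close> is eventually
  constant as x decreases to 0: it is the sign of \<open>snd w\<close>, or that of
  \<open>fst w\<close> if \<open>snd w = 0\<close>. Dominated convergence then gives the limit. The
  slopes of the oscillating sequence have no such limit.\<close>

lemma slope_tendsto:
  "(slope \<longlongrightarrow> (\<integral>w. fst w * of_bool (snd w > 0 \<or> snd w = 0 \<and> fst w > 0) \<partial>N)) (at_right 0)"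
proof -
  \<comment> \<open>The variable is t = 1/x, which turns the one-sided limit at 0 into a limit along
    \<open>at_top\<close>.\<close>
  have "((\<lambda>t. \<integral>w. fst w * indicator {0<..} (fst w * inverse t + snd w) \<partial>N) \<longlongrightarrow>
      (\<integral>w. fst w * of_bool (snd w > 0 \<or> snd w = 0 \<and> fst w > 0) \<partial>N)) at_top"
  proof (rule integral_dominated_convergence_at_top[where w = "\<lambda>_. 1"])
    show "AE w in N. ((\<lambda>t. fst w * indicator {0<..} (fst w * inverse t + snd w)) \<longlongrightarrow>
      fst w * of_bool (snd w > 0 \<or> snd w = 0 \<and> fst w > 0)) at_top"
    proof (rule AE_I2)
      fix w :: "real \<times> real"
      have lim: "((\<lambda>t. fst w * inverse t + snd w) \<longlongrightarrow> fst w * 0 + snd w) at_top"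
        by (intro tendsto_intros tendsto_inverse_0_at_top filterlim_ident)
      consider "snd w > 0" | "snd w < 0" | "snd w = 0" by linarith
      then have "eventually (\<lambda>t. (fst w * inverse t + snd w > 0) = (snd w > 0 \<or> snd w = 0 \<and> fst w > 0)) at_top"
      proof cases
        case 1
        then show ?thesis
          using order_tendstoD(1)[OF lim, of 0] by (auto elim: eventually_mono)
      next
        case 2
        then show ?thesis
          using order_tendstoD(2)[OF lim, of 0] by (auto elim: eventually_mono)
      next
        case 3
        show ?thesis
          using eventually_gt_at_top[of 0] by eventually_elim (auto simp: 3 zero_less_mult_iff)
      qed
      then have "eventually (\<lambda>t. fst w * indicator {0<..} (fst w * inverse t + snd w) =
          fst w * of_bool (snd w > 0 \<or> snd w = 0 \<and> fst w > 0)) at_top"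
        by eventually_elim (auto simp: indicator_def)
      then show "((\<lambda>t. fst w * indicator {0<..} (fst w * inverse t + snd w)) \<longlongrightarrow>
          fst w * of_bool (snd w > 0 \<or> snd w = 0 \<and> fst w > 0)) at_top"
        by (rule tendsto_eventually)
    qed
    show "\<forall>\<^sub>F t in at_top. AE w in N. norm (fst w * indicator {0<..} (fst w * inverse t + snd w)) \<le> 1"
      by (intro always_eventually allI AE_I2) (use abs_slope_integrand_le in auto)
  qed auto
  then show ?thesis
    unfolding filterlim_at_right_to_top by (simp add: slope_def inner_circle)
qed

text \<open>The product of \<open>relu (p * x + q)\<close> with \<phi> is continuous, and
  differentiable off the single kink - q / p, which exists only for p \<noteq> 0. The fundamental
  theorem of calculus tolerates such an exceptional point.\<close>

lemma relu_parts:
  fixes p q :: real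
  assumes "a \<le> b" and D: "\<And>x. x \<in> {a..b} \<Longrightarrow> (\<phi> has_real_derivative \<phi>' x) (at x)"
  shows "((\<lambda>x. relu (p * x + q) * \<phi>' x + p * indicator {0<..} (p * x + q) * \<phi> x) has_integral
    relu (p * b + q) * \<phi> b - relu (p * a + q) * \<phi> a) {a..b}"
proof (rule fundamental_theorem_of_calculus_interior_strong[where S = "if p = 0 then {} else {- q / p}"])
  show "continuous_on {a..b} (\<lambda>x. relu (p * x + q) * \<phi> x)"
    unfolding relu_def
    by (intro continuous_intros continuous_at_imp_continuous_on ballI DERIV_isCont[OF D])
  fix x assume x: "x \<in> {a<..<b} - (if p = 0 then {} else {- q / p})"
  have "((\<lambda>x. relu (p * x + q)) has_real_derivative p * indicator {0<..} (p * x + q)) (at x)"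
  proof -
    have "p = 0 \<or> p * x \<noteq> - q"
      using x by (auto simp: field_simps split: if_splits)
    then have "p = 0 \<or> p * x + q > 0 \<or> p * x + q < 0"
      by linarith
    then consider "p = 0" | "p * x + q > 0" | "p * x + q < 0"
      by blast
    then show ?thesis
    proof cases
      case 2
      have "((\<lambda>x. p * x + q) has_real_derivative p * indicator {0<..} (p * x + q)) (at x)"
        using 2 by (auto intro!: derivative_eq_intros)
      moreover have "open {x. p * x + q > 0}"
        by (intro open_Collect_less continuous_intros)
      ultimately show ?thesis
        by (rule has_field_derivative_transform_within_open) (use 2 in \<open>auto simp: relu_def\<close>)
    next
      case 3
      have "((\<lambda>x. 0) has_real_derivative p * indicator {0<..} (p * x + q)) (at x)"
        using 3 by auto
      moreover have "open {x. p * x + q < 0}"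
        by (intro open_Collect_less continuous_intros)
      ultimately show ?thesis
        by (rule has_field_derivative_transform_within_open) (use 3 in \<open>auto simp: relu_def\<close>)
    qed auto
  qed
  from DERIV_mult[OF this D[of x]] x
  show "((\<lambda>x. relu (p * x + q) * \<phi> x) has_vector_derivative
      relu (p * x + q) * \<phi>' x + p * indicator {0<..} (p * x + q) * \<phi> x) (at x)"
    by (simp add: has_real_derivative_iff_has_vector_derivative algebra_simps)
qed (use assms in auto)

text \<open>\<open>relu_parts\<close> for each \<open>w\<close>, integrated over \<open>N\<close>.
  Fubini applies because the kernel \<open>k\<close> is bounded and both measures are
  finite.\<close>

lemma potential_parts:
  assumes "a \<le> b" and D: "\<And>x. x \<in> {a..b} \<Longrightarrow> (\<phi> has_real_derivative \<phi>' x) (at x)"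
    and cont: "continuous_on {a..b} \<phi>'"
    and [measurable]: "\<phi> \<in> borel_measurable borel" "\<phi>' \<in> borel_measurable borel"
  shows "((\<lambda>x. potential x * \<phi>' x + slope x * \<phi> x) has_integral
    potential b * \<phi> b - potential a * \<phi> a) {a..b}"
proof -
  define L where "L = lebesgue_on {a..b}"
  interpret L: finite_measure L
    unfolding L_def by (rule finite_measure_lebesgue_on) simp
  interpret P: pair_sigma_finite L N ..
  interpret P: finite_measure "L \<Otimes>\<^sub>M N"
    by (rule finite_measure_pair_measure) unfold_locales
  define k where "k x w = relu (fst w * x + snd w) * \<phi>' x + fst w * indicator {0<..} (fst w * x + snd w) * \<phi> x"
    for x and w :: "real \<times> real"
  have [simp]: "space L = {a..b}"
    by (simp add: L_def)
  have [measurable]: "(\<lambda>x. x) \<in> borel_measurable L"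
    unfolding L_def by (intro measurable_restrict_space1 measurable_completion) simp
  have [measurable]: "\<phi> \<in> borel_measurable L" "\<phi>' \<in> borel_measurable L"
    unfolding L_def by (intro measurable_restrict_space1 measurable_completion; simp)+
  have [measurable]: "(\<lambda>p. fst (snd p)) \<in> borel_measurable (L \<Otimes>\<^sub>M N)"
    "(\<lambda>p. snd (snd p)) \<in> borel_measurable (L \<Otimes>\<^sub>M N)"
    by (rule measurable_compose[OF measurable_snd]; simp)+
  have [measurable]: "fst \<in> borel_measurable (L \<Otimes>\<^sub>M N)"
    using measurable_compose[OF measurable_fst, of "\<lambda>x. x" L borel N] by simp
  have k_meas: "(\<lambda>(x, w). k x w) \<in> borel_measurable (L \<Otimes>\<^sub>M N)"
    unfolding k_def case_prod_beta relu_def by measurable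
  have "continuous_on {a..b} \<phi>"
    by (intro continuous_at_imp_continuous_on ballI DERIV_isCont[OF D])
  then have "bounded (\<phi> ` {a..b})" "bounded (\<phi>' ` {a..b})"
    using cont by (auto intro!: compact_imp_bounded compact_continuous_image)
  then obtain B B' where B: "\<And>x. x \<in> {a..b} \<Longrightarrow> \<bar>\<phi> x\<bar> \<le> B" and B': "\<And>x. x \<in> {a..b} \<Longrightarrow> \<bar>\<phi>' x\<bar> \<le> B'"
    unfolding bounded_iff real_norm_def by blast
  have k_int: "integrable (L \<Otimes>\<^sub>M N) (\<lambda>(x, w). k x w)"
  proof (rule P.integrable_const_bound[OF AE_I2 k_meas])
    fix z assume "z \<in> space (L \<Otimes>\<^sub>M N)"
    then obtain x w where z: "z = (x, w)" "x \<in> {a..b}" "w \<in> space N"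
      by (auto simp: space_pair_measure)
    have "\<bar>k x w\<bar> \<le> \<bar>relu (fst w * x + snd w)\<bar> * \<bar>\<phi>' x\<bar> + \<bar>fst w * indicator {0<..} (fst w * x + snd w)\<bar> * \<bar>\<phi> x\<bar>"
      unfolding k_def abs_mult[symmetric] by (rule abs_triangle_ineq)
    also have "\<dots> \<le> (\<bar>a\<bar> + \<bar>b\<bar> + 1) * B' + 1 * B"
      using z abs_relu_le[of w x] abs_slope_integrand_le[of w x]
      by (intro add_mono mult_mono B B') auto
    finally show "norm (case z of (x, w) \<Rightarrow> k x w) \<le> (\<bar>a\<bar> + \<bar>b\<bar> + 1) * B' + 1 * B"
      by (simp add: z)
  qed
  have inner_N: "(\<integral>w. k x w \<partial>N) = potential x * \<phi>' x + slope x * \<phi> x" for x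
    by (simp add: k_def potential_def slope_def inner_circle integrable_relu integrable_slope)
  have "integrable L (\<lambda>x. potential x * \<phi>' x + slope x * \<phi> x)"
    using P.integrable_fst[OF k_int] by (simp add: inner_N)
  then have "((\<lambda>x. potential x * \<phi>' x + slope x * \<phi> x) has_integral
      (\<integral>x. potential x * \<phi>' x + slope x * \<phi> x \<partial>L)) {a..b}"
    unfolding L_def by (rule has_integral_integral_lebesgue_on) simp
  moreover have "(\<integral>x. potential x * \<phi>' x + slope x * \<phi> x \<partial>L) = potential b * \<phi> b - potential a * \<phi> a"
  proof -
    have "(\<integral>x. potential x * \<phi>' x + slope x * \<phi> x \<partial>L) = (\<integral>w. (\<integral>x. k x w \<partial>L) \<partial>N)"
      unfolding inner_N[symmetric] by (rule P.Fubini_integral[OF k_int, symmetric])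
    also have "\<dots> = (\<integral>w. relu (fst w * b + snd w) * \<phi> b - relu (fst w * a + snd w) * \<phi> a \<partial>N)"
    proof (rule Bochner_Integration.integral_cong[OF refl])
      fix w assume w: "w \<in> space N"
      have "integrable L (\<lambda>x. k x w)"
      proof (rule L.integrable_const_bound[OF AE_I2])
        show "(\<lambda>x. k x w) \<in> borel_measurable L"
          unfolding k_def relu_def by measurable
        fix x assume x: "x \<in> space L"
        have "\<bar>k x w\<bar> \<le> \<bar>relu (fst w * x + snd w)\<bar> * \<bar>\<phi>' x\<bar> + \<bar>fst w * indicator {0<..} (fst w * x + snd w)\<bar> * \<bar>\<phi> x\<bar>"
          unfolding k_def abs_mult[symmetric] by (rule abs_triangle_ineq)
        also have "\<dots> \<le> (\<bar>a\<bar> + \<bar>b\<bar> + 1) * B' + 1 * B"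
          using x w abs_relu_le[of w x] abs_slope_integrand_le[of w x]
          by (intro add_mono mult_mono B B') auto
        finally show "norm (k x w) \<le> (\<bar>a\<bar> + \<bar>b\<bar> + 1) * B' + 1 * B"
          by simp
      qed
      then have "((\<lambda>x. k x w) has_integral (\<integral>x. k x w \<partial>L)) {a..b}"
        unfolding L_def by (rule has_integral_integral_lebesgue_on) simp
      moreover have "((\<lambda>x. k x w) has_integral
          relu (fst w * b + snd w) * \<phi> b - relu (fst w * a + snd w) * \<phi> a) {a..b}"
        unfolding k_def using assms(1) D by (rule relu_parts)
      ultimately show "(\<integral>x. k x w \<partial>L) = relu (fst w * b + snd w) * \<phi> b - relu (fst w * a + snd w) * \<phi> a"
        by (rule has_integral_unique)
    qed
    also have "\<dots> = potential b * \<phi> b - potential a * \<phi> a"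
      by (simp add: potential_def inner_circle integrable_relu)
    finally show ?thesis .
  qed
  ultimately show ?thesis by simp
qed

end

text \<open>The properties of a Barron function on which the lower bound rests; \<open>g\<close> is
  its derivative. Besides test functions, \<phi> = 1 will give the fundamental theorem of calculus
  for \<open>u\<close>, and \<phi> = 1/x that for u/x.\<close>

lemma barron_spaceE:
  assumes "u \<in> barron_space"
  obtains g L C where "g \<in> borel_measurable borel" "\<And>x. \<bar>g x\<bar> \<le> C" "(g \<longlongrightarrow> L) (at_right 0)"
    "\<And>x y. \<bar>u x - u y\<bar> \<le> C * \<bar>x - y\<bar>"
    "\<And>a b \<phi> \<phi>'. a \<le> b \<Longrightarrow> (\<And>x. x \<in> {a..b} \<Longrightarrow> (\<phi> has_real_derivative \<phi>' x) (at x)) \<Longrightarrow>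
      continuous_on {a..b} \<phi>' \<Longrightarrow> \<phi> \<in> borel_measurable borel \<Longrightarrow> \<phi>' \<in> borel_measurable borel \<Longrightarrow>
      ((\<lambda>x. u x * \<phi>' x + g x * \<phi> x) has_integral u b * \<phi> b - u a * \<phi> a) {a..b}"
proof -
  obtain \<mu> where \<mu>: "signed_measure circle_borel \<mu>"
    and u: "\<And>x. u x = signed_integral circle_borel \<mu> (\<lambda>w. relu (w \<bullet> (x, 1)))"
    using assms by (auto simp: barron_space_def)
  interpret P: finite_circle_measure "pos_variation circle_borel \<mu>"
    using finite_measure_pos_variation[OF \<mu>]
    by (intro finite_circle_measure.intro finite_circle_measure_axioms.intro) auto
  interpret Q: finite_circle_measure "pos_variation circle_borel (\<lambda>A. - \<mu> A)"
    using finite_measure_pos_variation[OF signed_measure_uminus[OF \<mu>]]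
    by (intro finite_circle_measure.intro finite_circle_measure_axioms.intro) auto
  have u': "u x = P.potential x - Q.potential x" for x
    by (simp add: u signed_integral_def P.potential_def Q.potential_def)
  let ?m = "\<lambda>M. measure M (space M)"
  let ?C = "?m (pos_variation circle_borel \<mu>) + ?m (pos_variation circle_borel (\<lambda>A. - \<mu> A))"
  show ?thesis
  proof (rule that[of "\<lambda>x. P.slope x - Q.slope x" ?C])
    show "(\<lambda>x. P.slope x - Q.slope x) \<in> borel_measurable borel"
      by (intro borel_measurable_diff P.measurable_slope Q.measurable_slope)
    show "((\<lambda>x. P.slope x - Q.slope x) \<longlongrightarrow>
      (\<integral>w. fst w * of_bool (snd w > 0 \<or> snd w = 0 \<and> fst w > 0) \<partial>pos_variation circle_borel \<mu>) -
      (\<integral>w. fst w * of_bool (snd w > 0 \<or> snd w = 0 \<and> fst w > 0) \<partial>pos_variation circle_borel (\<lambda>A. - \<mu> A))) (at_right 0)"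
      by (intro tendsto_diff P.slope_tendsto Q.slope_tendsto)
    show "\<bar>P.slope x - Q.slope x\<bar> \<le> ?C" for x
      using P.abs_slope_le[of x] Q.abs_slope_le[of x] by linarith
    show "\<bar>u x - u y\<bar> \<le> ?C * \<bar>x - y\<bar>" for x y
      using P.potential_lipschitz[of x y] Q.potential_lipschitz[of x y] unfolding u' distrib_right by linarith
    fix a b :: real and \<phi> \<phi>' :: "real \<Rightarrow> real"
    assume *: "a \<le> b" "\<And>x. x \<in> {a..b} \<Longrightarrow> (\<phi> has_real_derivative \<phi>' x) (at x)"
      "continuous_on {a..b} \<phi>'" "\<phi> \<in> borel_measurable borel" "\<phi>' \<in> borel_measurable borel"
    from has_integral_diff[OF P.potential_parts[OF *] Q.potential_parts[OF *]]
    show "((\<lambda>x. u x * \<phi>' x + (P.slope x - Q.slope x) * \<phi> x) has_integral u b * \<phi> b - u a * \<phi> a) {a..b}"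
      by (simp add: u' algebra_simps)
  qed
qed

section \<open>Bounded functions in Lebesgue spaces\<close>

lemma lp_spaceI_bounded:
  assumes "f \<in> borel_measurable borel" "\<And>x. x \<in> S \<Longrightarrow> \<bar>f x\<bar> \<le> C" "S \<in> lmeasurable" "0 \<le> p"
  shows "f \<in> lp_space p S"
proof -
  have "f \<in> borel_measurable (lebesgue_on S)"
    using assms(1) by (intro measurable_restrict_space1 measurable_completion) simp
  moreover have "AE x in lebesgue_on S. \<bar>f x\<bar> \<le> C"
    using assms(2) by (intro AE_I2) simp
  \<comment> \<open>For p = \<infinity> the exponent is the default value 0, and the claim still
    holds.\<close>
  moreover have "integrable (lebesgue_on S) (\<lambda>x. \<bar>f x\<bar> powr real_of_ereal p)"
  proof (rule integrable_bounded_borel)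
    show "(\<lambda>x. \<bar>f x\<bar> powr real_of_ereal p) \<in> borel_measurable borel"
      using assms(1) by measurable
    show "\<bar>\<bar>f x\<bar> powr real_of_ereal p\<bar> \<le> C powr real_of_ereal p" if "x \<in> S" for x
      using assms(2)[OF that] assms(4) by (simp add: powr_mono2 real_of_ereal_pos)
  qed fact
  ultimately show ?thesis
    unfolding lp_space_def by auto
qed

section \<open>The oscillating minimizing sequence\<close>

text \<open>\<open>arcsin (sin y)\<close> is the triangle wave with slopes +1 and -1 and height
  pi/2. The phase N/x has derivative - N/x^2, whose size the factor x^2/N cancels.\<close>

definition osc :: "real \<Rightarrow> real \<Rightarrow> real" where
  "osc N x = x\<^sup>2 * arcsin (sin (N / x)) / N"

text \<open>The derivative of \<open>osc\<close> away from the corners, where cos (N/x) = 0; at the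
  corners the value is a convention.\<close>

definition osc_slope :: "real \<Rightarrow> real \<Rightarrow> real" where
  "osc_slope N x = 2 * x * arcsin (sin (N / x)) / N - (if cos (N / x) \<ge> 0 then 1 else - 1)"

lemma abs_arcsin_sin_le: "\<bar>arcsin (sin y)\<bar> \<le> 2"
  using arcsin_bounded[of "sin y"] pi_less_4 by auto

lemma continuous_arcsin_sin: "continuous_on A (\<lambda>y. arcsin (sin y))"
  by (intro continuous_on_arcsin continuous_intros) auto

lemma osc_measurable: "osc N \<in> borel_measurable borel"
  and osc_slope_measurable: "osc_slope N \<in> borel_measurable borel"
proof -
  have [measurable]: "(\<lambda>y::real. arcsin (sin y)) \<in> borel_measurable borel"
    by (intro borel_measurable_continuous_onI continuous_arcsin_sin)
  have [measurable]: "(\<lambda>x. arcsin (sin (N / x))) \<in> borel_measurable borel"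
    by (rule measurable_compose[of "\<lambda>x. N / x" borel borel "\<lambda>y. arcsin (sin y)"]) measurable
  show "osc N \<in> borel_measurable borel" "osc_slope N \<in> borel_measurable borel"
    unfolding osc_def[abs_def] osc_slope_def[abs_def] by measurable
qed

text \<open>The derivative of arcsin at sin y is 1/|cos y|, so the triangle wave has slope cos y /
  |cos y|, the sign of the cosine.\<close>

lemma osc_DERIV:
  assumes "x > 0" "N > 0" "cos (N / x) \<noteq> 0"
  shows "(osc N has_real_derivative osc_slope N x) (at x)"
proof -
  let ?y = "N / x"
  have "(cos ?y)\<^sup>2 > 0"
    using assms(3) by simp
  then have "(sin ?y)\<^sup>2 < 1"
    using sin_cos_squared_add[of ?y] by linarith
  then have "\<bar>sin ?y\<bar> < 1"
    by (rule abs_square_less_1[THEN iffD1])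
  then have "(arcsin has_real_derivative inverse (sqrt (1 - (sin ?y)\<^sup>2))) (at (sin ?y))"
    by (intro DERIV_arcsin) auto
  moreover have "sqrt (1 - (sin ?y)\<^sup>2) = \<bar>cos ?y\<bar>"
    by (simp add: cos_squared_eq[symmetric])
  ultimately have A: "(arcsin has_real_derivative inverse \<bar>cos ?y\<bar>) (at (sin ?y))"
    by simp
  have "((\<lambda>x. N / x) has_real_derivative - N / x\<^sup>2) (at x)"
    using assms(1) by (auto intro!: derivative_eq_intros simp: power2_eq_square)
  then have "((\<lambda>x. sin (N / x)) has_real_derivative cos ?y * (- N / x\<^sup>2)) (at x)"
    by (rule DERIV_chain'[OF _ DERIV_sin])
  then have "((\<lambda>x. arcsin (sin (N / x))) has_real_derivative inverse \<bar>cos ?y\<bar> * (cos ?y * (- N / x\<^sup>2))) (at x)"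
    by (rule DERIV_chain2[where f = arcsin and g = "\<lambda>x. sin (N / x)", OF A])
  moreover have "inverse \<bar>cos ?y\<bar> * (cos ?y * (- N / x\<^sup>2)) = (if cos ?y \<ge> 0 then 1 else - 1) * (- N / x\<^sup>2)"
    using assms(3) by auto
  ultimately have *: "((\<lambda>x. arcsin (sin (N / x))) has_real_derivative (if cos ?y \<ge> 0 then 1 else - 1) * (- N / x\<^sup>2)) (at x)"
    by (rule DERIV_cong)
  have "((\<lambda>x. x\<^sup>2 * arcsin (sin (N / x)) / N) has_real_derivative
      (2 * x * arcsin (sin ?y) + (if cos ?y \<ge> 0 then 1 else - 1) * (- N / x\<^sup>2) * x\<^sup>2) / N) (at x)"
    by (intro DERIV_cdivide DERIV_mult'[THEN DERIV_cong, OF _ *]) (auto intro!: derivative_eq_intros)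
  then have "((\<lambda>x. x\<^sup>2 * arcsin (sin (N / x)) / N) has_real_derivative osc_slope N x) (at x)"
    by (rule DERIV_cong) (use assms in \<open>auto simp: osc_slope_def field_simps\<close>)
  then show ?thesis
    by (simp add: osc_def[abs_def])
qed

text \<open>The corners accumulate only at 0, so [a,b] with a > 0 contains finitely many of
  them.\<close>

lemma osc_parts:
  assumes "0 < a" "a \<le> b" "N > 0" and D: "\<And>x. (\<phi> has_real_derivative \<phi>' x) (at x)"
  shows "((\<lambda>x. osc N x * \<phi>' x + osc_slope N x * \<phi> x) has_integral osc N b * \<phi> b - osc N a * \<phi> a) {a..b}"
proof (rule fundamental_theorem_of_calculus_interior_strong)
  let ?S = "{x \<in> {a..b}. cos (N / x) = 0}"
  show "finite ?S"
  proof (rule finite_subset)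
    \<comment> \<open>At a corner N/x = i pi/2 with an integer i > 0; since pi/2 \<ge> 1, this gives
      i \<le> N/x \<le> N/a.\<close>
    show "?S \<subseteq> (\<lambda>i. N / (of_int i * (pi / 2))) ` {0..\<lceil>N / a\<rceil>}"
    proof
      fix x assume x: "x \<in> ?S"
      then obtain i :: int where i: "N / x = of_int i * (pi / 2)"
        by (auto simp: cos_zero_iff_int)
      have "0 < N / x" "N / x \<le> N / a"
        using x assms by (auto intro!: divide_left_mono)
      then have "0 < real_of_int i"
        unfolding i using pi_gt_zero by (simp add: zero_less_mult_iff)
      then have "real_of_int i * 1 \<le> real_of_int i * (pi / 2)"
        using pi_ge_two by (intro mult_left_mono) auto
      then have "real_of_int i \<le> N / a"
        using i \<open>N / x \<le> N / a\<close> by linarith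
      moreover have "0 < i"
        using \<open>0 < real_of_int i\<close> by simp
      ultimately have "i \<in> {0..\<lceil>N / a\<rceil>}"
        by (auto simp: le_ceiling_iff)
      moreover have "x = N / (of_int i * (pi / 2))"
        using i x assms by (auto simp: field_simps)
      ultimately show "x \<in> (\<lambda>i. N / (of_int i * (pi / 2))) ` {0..\<lceil>N / a\<rceil>}"
        by blast
    qed
  qed simp
  show "continuous_on {a..b} (\<lambda>x. osc N x * \<phi> x)"
  proof (intro continuous_on_mult)
    have "continuous_on {a..b} (\<lambda>x. arcsin (sin (N / x)))"
      using assms by (intro continuous_on_compose2[OF continuous_arcsin_sin[of UNIV]] continuous_intros) auto
    then show "continuous_on {a..b} (osc N)"
      unfolding osc_def[abs_def] using assms by (intro continuous_intros) auto
    show "continuous_on {a..b} \<phi>"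
      by (intro continuous_at_imp_continuous_on ballI DERIV_isCont[OF D])
  qed
  show "((\<lambda>x. osc N x * \<phi> x) has_vector_derivative osc N x * \<phi>' x + osc_slope N x * \<phi> x) (at x)"
    if "x \<in> {a<..<b} - ?S" for x
    using DERIV_mult'[OF osc_DERIV[of x N] D[of x]] that assms
    by (simp add: has_real_derivative_iff_has_vector_derivative)
qed (use assms in auto)

section \<open>Size of the oscillating functions and of their energy\<close>

lemma abs_osc_le: "N > 0 \<Longrightarrow> \<bar>osc N x\<bar> \<le> 2 * x\<^sup>2 / N"
  unfolding osc_def using mult_left_mono[OF abs_arcsin_sin_le, of "x\<^sup>2" "N / x"]
  by (simp add: abs_mult divide_right_mono mult.commute)

lemma abs_osc_error_le:
  assumes "N > 0" "x > 0"
  shows "\<bar>2 * x * arcsin (sin (N / x)) / N\<bar> \<le> 4 * x / N"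
  using mult_left_mono[OF abs_arcsin_sin_le, of "2 * x" "N / x"] assms
  by (simp add: abs_mult divide_right_mono)

text \<open>616 = 36 + 576 + 4, one summand per term. They come from |u| \<le> 2x^2/N, |u - x| \<le>
  3x and |u'^2 - 1| \<le> 24x/N, whose powers of x absorb the singular weights.\<close>

lemma J_integrand_osc_le:
  assumes "N \<ge> 1" and x: "x \<in> {0<..<1}"
  shows "(osc N x)\<^sup>2 * (osc N x - x)\<^sup>2 / x ^ 5 + ((osc_slope N x)\<^sup>2 - 1)\<^sup>2 / x + (osc N x)\<^sup>2 \<le> 616 / N\<^sup>2"
proof -
  have pos: "0 < x" "x < 1" "0 < N" and xx: "x\<^sup>2 \<le> x" "x\<^sup>2 \<le> 1"
    using assms by (auto simp: power2_eq_square mult_le_one)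
  have u: "\<bar>osc N x\<bar> \<le> 2 * x\<^sup>2 / N"
    by (rule abs_osc_le) fact
  then have u2: "(osc N x)\<^sup>2 \<le> (2 * x\<^sup>2 / N)\<^sup>2"
    using abs_ge_self[of "2 * x\<^sup>2 / N"] by (intro abs_le_square_iff[THEN iffD1]) linarith
  have "2 * x\<^sup>2 / N \<le> 2 * x"
  proof -
    have "2 * x\<^sup>2 / N \<le> 2 * x\<^sup>2 / 1"
      using assms(1) by (intro divide_left_mono) auto
    then show ?thesis using xx by simp
  qed
  then have "\<bar>osc N x - x\<bar> \<le> \<bar>3 * x\<bar>"
    using u pos by linarith
  then have "(osc N x - x)\<^sup>2 \<le> (3 * x)\<^sup>2"
    by (rule abs_le_square_iff[THEN iffD1])
  then have "(osc N x)\<^sup>2 * (osc N x - x)\<^sup>2 / x ^ 5 \<le> (2 * x\<^sup>2 / N)\<^sup>2 * (3 * x)\<^sup>2 / x ^ 5"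
    using u2 pos by (intro divide_right_mono mult_mono) auto
  also have "\<dots> = 36 * x / N\<^sup>2"
    using pos by (simp add: field_simps power2_eq_square eval_nat_numeral)
  also have "\<dots> \<le> 36 / N\<^sup>2"
    using pos by (intro divide_right_mono) auto
  finally have 1: "(osc N x)\<^sup>2 * (osc N x - x)\<^sup>2 / x ^ 5 \<le> 36 / N\<^sup>2" .
  define e where "e = 2 * x * arcsin (sin (N / x)) / N"
  have e: "\<bar>e\<bar> \<le> 4 * x / N"
    unfolding e_def using pos by (intro abs_osc_error_le) auto
  have "\<bar>(osc_slope N x)\<^sup>2 - 1\<bar> \<le> \<bar>e\<bar> * (\<bar>e\<bar> + 2)"
  proof -
    \<comment> \<open>The slope is e - 1 or e + 1, according to the sign of the cosine.\<close>
    have "(osc_slope N x)\<^sup>2 - 1 = e * (e - 2) \<or> (osc_slope N x)\<^sup>2 - 1 = e * (e + 2)"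
      unfolding osc_slope_def e_def[symmetric] by (auto simp: power2_eq_square algebra_simps)
    then show ?thesis
      by (auto simp: abs_mult intro!: mult_left_mono)
  qed
  also have "\<dots> \<le> (4 * x / N) * (4 + 2)"
  proof (intro mult_mono add_mono e)
    have "4 * x / N \<le> 4 / 1"
      using pos assms(1) by (intro frac_le) auto
    then show "\<bar>e\<bar> \<le> 4" using e by simp
  qed (use pos in auto)
  also have "\<dots> = \<bar>24 * x / N\<bar>"
    using pos by simp
  finally have "((osc_slope N x)\<^sup>2 - 1)\<^sup>2 \<le> (24 * x / N)\<^sup>2"
    by (rule abs_le_square_iff[THEN iffD1])
  then have "((osc_slope N x)\<^sup>2 - 1)\<^sup>2 / x \<le> (24 * x / N)\<^sup>2 / x"
    using pos by (intro divide_right_mono) auto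
  also have "\<dots> = 576 * x / N\<^sup>2"
    using pos by (simp add: field_simps power2_eq_square)
  also have "\<dots> \<le> 576 / N\<^sup>2"
    using pos by (intro divide_right_mono) auto
  finally have 2: "((osc_slope N x)\<^sup>2 - 1)\<^sup>2 / x \<le> 576 / N\<^sup>2" .
  have "(2 * x\<^sup>2 / N)\<^sup>2 \<le> (2 / N)\<^sup>2"
    using xx pos by (intro power_mono divide_right_mono) auto
  then have 3: "(osc N x)\<^sup>2 \<le> 4 / N\<^sup>2"
    using u2 by (simp add: power_divide)
  have "36 / N\<^sup>2 + 576 / N\<^sup>2 + 4 / N\<^sup>2 = 616 / N\<^sup>2"
    by (simp add: add_divide_distrib[symmetric])
  with 1 2 3 show ?thesis by linarith
qed

lemma
  assumes N: "N \<ge> 1"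
  shows osc_in_sobolev1: "0 \<le> p \<Longrightarrow> osc N \<in> sobolev1 p {0<..<1}"
    and J_osc_le: "J (osc N) \<le> ennreal (616 / N\<^sup>2)"
proof -
  have bound: "\<bar>osc N x\<bar> \<le> 5" "\<bar>osc_slope N x\<bar> \<le> 5" if "x \<in> {0<..<1}" for x
  proof -
    have "2 * x\<^sup>2 / N \<le> 2 / 1" "4 * x / N \<le> 4 / 1"
      using that N by (intro frac_le; auto simp: power_le_one)+
    then show "\<bar>osc N x\<bar> \<le> 5"
      using abs_osc_le[of N x] N by linarith
    have "\<bar>2 * x * arcsin (sin (N / x)) / N\<bar> \<le> 4 * x / N"
      using N that by (intro abs_osc_error_le) auto
    then have "\<bar>2 * x * arcsin (sin (N / x)) / N\<bar> \<le> 4"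
      using \<open>4 * x / N \<le> 4 / 1\<close> by linarith
    moreover have "\<bar>e - (if c then 1 else - 1)\<bar> \<le> 5" if "\<bar>e\<bar> \<le> 4" for e :: real and c
      using that by auto
    ultimately show "\<bar>osc_slope N x\<bar> \<le> 5"
      unfolding osc_slope_def by blast
  qed
  have weak: "has_weak_deriv {0<..<1} (osc N) (osc_slope N)"
    using bound N by (intro has_weak_derivI[of _ 5] osc_measurable osc_slope_measurable osc_parts)
      (auto intro: smooth_DERIV)
  show "osc N \<in> sobolev1 p {0<..<1}" if "0 \<le> p"
    using weak bound that unfolding sobolev1_def
    by (auto intro!: lp_spaceI_bounded[of _ _ 5] bexI[of _ "osc_slope N"] osc_measurable osc_slope_measurable)
  have "J (osc N) \<le> (\<integral>\<^sup>+x. ennreal (616 / N\<^sup>2) \<partial>lebesgue_on {0<..<1::real})"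
    unfolding J_eq[OF weak] by (intro nn_integral_mono ennreal_leI J_integrand_osc_le N) simp
  also have "\<dots> = ennreal (616 / N\<^sup>2)"
    by (simp add: emeasure_restrict_space)
  finally show "J (osc N) \<le> ennreal (616 / N\<^sup>2)" .
qed

lemma INF_J_sobolev1:
  assumes "0 \<le> p"
  shows "(INF u \<in> sobolev1 p {0<..<1}. J u) = 0"
proof -
  have "(INF u \<in> sobolev1 p {0<..<1}. J u) \<le> ennreal (616 * inverse (real (Suc n)) ^ 2)" for n
  proof -
    have "(INF u \<in> sobolev1 p {0<..<1}. J u) \<le> J (osc (real (Suc n)))"
      using assms by (intro INF_lower osc_in_sobolev1) auto
    also have "\<dots> \<le> ennreal (616 / (real (Suc n))\<^sup>2)"
      by (intro J_osc_le) simp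
    finally show ?thesis
      by (simp add: divide_inverse power_inverse)
  qed
  moreover have "(\<lambda>n. ennreal (616 * inverse (real (Suc n)) ^ 2)) \<longlonglongrightarrow> ennreal (616 * 0 ^ 2)"
    by (intro tendsto_ennrealI tendsto_intros LIMSEQ_inverse_real_of_nat)
  ultimately have "(INF u \<in> sobolev1 p {0<..<1}. J u) \<le> ennreal (616 * 0 ^ 2)"
    by (intro LIMSEQ_le_const) auto
  then show ?thesis by simp
qed

section \<open>The lower bound for Barron functions\<close>

text \<open>Turns an explicit antiderivative into a lower bound for \<open>J\<close>.
  \<open>h\<close> may change sign: its integral is at most that of its positive part, which is
  below the truncation of \<open>f\<close>.\<close>

lemma nn_integral_ge_integral:
  fixes h :: "real \<Rightarrow> real"
  assumes h: "h \<in> borel_measurable borel" "\<And>x. x \<in> {a..b} \<Longrightarrow> \<bar>h x\<bar> \<le> C"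
    and ab: "0 < a" "b < 1" and le: "\<And>x. x \<in> {a<..<b} \<Longrightarrow> h x \<le> f x"
    and int: "(h has_integral r) {a..b}"
  shows "ennreal r \<le> (\<integral>\<^sup>+x. ennreal (f x) \<partial>lebesgue_on {0<..<1})"
proof -
  have i: "integrable (lebesgue_on {a<..<b}) h"
    using h by (intro integrable_bounded_borel[of _ _ C]) auto
  have "(h has_integral (LINT x|lebesgue_on {a<..<b}. h x)) {a<..<b}"
    by (rule has_integral_integral_lebesgue_on[OF i]) simp
  moreover have "(h has_integral r) {a<..<b}"
    using int by (simp add: has_integral_Icc_iff_Ioo)
  ultimately have "r = (LINT x|lebesgue_on {a<..<b}. h x)"
    using has_integral_unique by blast
  also have "\<dots> \<le> enn2real (\<integral>\<^sup>+x. ennreal (h x) \<partial>lebesgue_on {a<..<b})"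
    by (subst real_lebesgue_integral_def[OF i]) simp
  finally have "ennreal r \<le> ennreal (enn2real (\<integral>\<^sup>+x. ennreal (h x) \<partial>lebesgue_on {a<..<b}))"
    by (rule ennreal_leI)
  also have "\<dots> = (\<integral>\<^sup>+x. ennreal (h x) \<partial>lebesgue_on {a<..<b})"
    using i by (simp add: real_integrable_def less_top[symmetric])
  also have "\<dots> \<le> (\<integral>\<^sup>+x. ennreal (f x) \<partial>lebesgue_on {a<..<b})"
    using le by (intro nn_integral_mono ennreal_leI) simp
  also have "\<dots> \<le> (\<integral>\<^sup>+x. ennreal (f x) \<partial>lebesgue_on {0<..<1})"
    using ab by (subst (1 2) nn_integral_restrict_space)
      (auto intro!: nn_integral_mono split: split_indicator)
  finally show ?thesis .
qed

text \<open>The integral of c/x diverges logarithmically at 0, so it reaches the value 1 on a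
  suitable interval close to 0.\<close>

lemma nn_integral_ge_of_pole:
  assumes c: "c > 0" and ev: "\<forall>\<^sub>F x in at_right 0. c / x \<le> f x"
  shows "1 \<le> (\<integral>\<^sup>+x. ennreal (f x) \<partial>lebesgue_on {0<..<1})"
proof -
  obtain d where d: "d > 0" "\<And>x. 0 < x \<Longrightarrow> x < d \<Longrightarrow> c / x \<le> f x"
    using ev by (auto simp: eventually_at_right_field)
  define b where "b = min d 1 / 2"
  \<comment> \<open>Chosen so that c (ln b - ln a) = 1.\<close>
  define a where "a = b * exp (- (1 / c))"
  have b: "0 < b" "b < d" "b < 1"
    using d by (auto simp: b_def)
  have a: "0 < a" "a \<le> b"
    using b c by (auto simp: a_def mult_le_cancel_left1)
  have "ln a = ln b - 1 / c"
    using b by (simp add: a_def ln_mult)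
  then have "c * ln b - c * ln a = 1"
    using c by (simp add: right_diff_distrib)
  moreover have "((\<lambda>x. c / x) has_integral c * ln b - c * ln a) {a..b}"
    using a by (intro fundamental_theorem_of_calculus)
      (auto intro!: derivative_eq_intros simp: has_real_derivative_iff_has_vector_derivative[symmetric])
  ultimately have "ennreal 1 \<le> (\<integral>\<^sup>+x. ennreal (f x) \<partial>lebesgue_on {0<..<1})"
    using a b c d(2) by (intro nn_integral_ge_integral[of "\<lambda>x. c / x" a b "c / a"])
      (auto intro!: divide_left_mono)
  then show ?thesis by simp
qed

text \<open>u(x)/x is the mean of \<open>g\<close> over [0,x], so it inherits the right limit of
  \<open>g\<close>.\<close>

lemma tendsto_slope_at_0:
  fixes u g :: "real \<Rightarrow> real"
  assumes int: "\<And>x. 0 < x \<Longrightarrow> (g has_integral u x) {0..x}" and g: "(g \<longlongrightarrow> L) (at_right 0)"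
  shows "((\<lambda>x. u x / x) \<longlongrightarrow> L) (at_right 0)"
proof (rule tendstoI)
  fix e :: real assume "e > 0"
  then have "\<forall>\<^sub>F x in at_right 0. dist (g x) L < e / 2"
    using g by (intro tendstoD) auto
  then obtain d where d: "d > 0" "\<And>x. 0 < x \<Longrightarrow> x < d \<Longrightarrow> \<bar>g x - L\<bar> < e / 2"
    by (auto simp: eventually_at_right_field dist_real_def)
  have "dist (u x / x) L < e" if x: "0 < x" "x < d" for x
  proof -
    have "((\<lambda>t. g t - L) has_integral u x - L * x) {0..x}"
      using has_integral_diff[OF int[OF x(1)] has_integral_const_real[of L 0 x]] x by (simp add: mult.commute)
    \<comment> \<open>The right limit says nothing about \<open>g 0\<close>, hence the exceptional
      set {0}.\<close>
    then have "norm (u x - L * x) \<le> e / 2 * measure lborel (cbox 0 x)"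
      by (intro has_integral_bound_spike_finite[where S = "{0}" and f = "\<lambda>t. g t - L"])
        (use d x \<open>e > 0\<close> in \<open>auto intro!: less_imp_le\<close>)
    then have "\<bar>u x - L * x\<bar> \<le> e / 2 * x"
      using x by simp
    moreover have "u x / x - L = (u x - L * x) / x"
      using x by (simp add: field_simps)
    ultimately have "\<bar>u x / x - L\<bar> \<le> e / 2"
      using x by (simp add: divide_le_eq)
    then show ?thesis
      using \<open>e > 0\<close> by (simp add: dist_real_def)
  qed
  then show "\<forall>\<^sub>F x in at_right 0. dist (u x / x) L < e"
    using d(1) by (auto simp: eventually_at_right_field)
qed

text \<open>\<open>b\<close> is the first point at which v \<le> q, and \<open>a\<close> is the last
  point before it at which v \<ge> p.\<close>

lemma crossing_interval:
  fixes v :: "real \<Rightarrow> real"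
  assumes "s \<le> t" "continuous_on {s..t} v" "v s \<ge> p" "v t \<le> q" "q < p"
  obtains a b where "s \<le> a" "a < b" "b \<le> t" "v a \<ge> p" "v b \<le> q" "\<And>x. x \<in> {a<..<b} \<Longrightarrow> q < v x \<and> v x < p"
proof -
  have comp: "compact {x \<in> {c..d}. P (v x)}"
    if "closed {y. P y}" "{c..d} \<subseteq> {s..t}" for c d P
  proof -
    have "closed ({c..d} \<inter> v -` {y. P y})"
      using that assms(2) by (intro continuous_closed_preimage) (auto intro: continuous_on_subset)
    moreover have "{x \<in> {c..d}. P (v x)} = {c..d} \<inter> ({c..d} \<inter> v -` {y. P y})"
      by auto
    ultimately show ?thesis
      by (simp only: compact_Int_closed[OF compact_Icc])
  qed
  have "\<exists>b\<in>{x \<in> {s..t}. v x \<le> q}. \<forall>y\<in>{x \<in> {s..t}. v x \<le> q}. b \<le> y"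
    using assms by (intro compact_attains_inf comp closed_Collect_le continuous_intros) auto
  then obtain b where b: "b \<in> {s..t}" "v b \<le> q" "\<And>y. y \<in> {s..t} \<Longrightarrow> v y \<le> q \<Longrightarrow> b \<le> y"
    by auto
  have "\<exists>a\<in>{x \<in> {s..b}. p \<le> v x}. \<forall>y\<in>{x \<in> {s..b}. p \<le> v x}. y \<le> a"
    using assms b by (intro compact_attains_sup comp closed_Collect_le continuous_intros) auto
  then obtain a where a: "a \<in> {s..b}" "p \<le> v a" "\<And>y. y \<in> {s..b} \<Longrightarrow> p \<le> v y \<Longrightarrow> y \<le> a"
    by auto
  have "a \<noteq> b"
    using a(2) b(2) assms(5) by auto
  show ?thesis
  proof (rule that[of a b])
    show "q < v x \<and> v x < p" if "x \<in> {a<..<b}" for x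
      using a(1) a(3)[of x] b(1) b(3)[of x] that by force
  qed (use a b \<open>a \<noteq> b\<close> in auto)
qed

text \<open>For v = u/x and s = u', the left side is - x v' / 72. Write P and Q for the two summands
  on the right. On the band P \<ge> (3/16)^2 = 9/256, while v - s \<le> 3/4 + 9/8 + Q/2. The factor
  72 suffices because 72 * 9/256 exceeds 15/8.\<close>

lemma transition_cost:
  fixes v s :: real
  assumes "1 / 4 < v" "v < 3 / 4"
  shows "(v - s) / 72 \<le> v\<^sup>2 * (v - 1)\<^sup>2 + (s\<^sup>2 - 1)\<^sup>2"
proof -
  have "0 \<le> (v - 1 / 4) * (3 / 4 - v)"
    using assms by (intro mult_nonneg_nonneg) auto
  moreover have "(v - 1 / 4) * (3 / 4 - v) = v * (1 - v) - 3 / 16"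
    by (simp add: field_simps)
  ultimately have "3 / 16 \<le> v * (1 - v)"
    by linarith
  then have "(3 / 16)\<^sup>2 \<le> (v * (1 - v))\<^sup>2"
    by (intro power_mono) auto
  then have 1: "9 / 256 \<le> v\<^sup>2 * (v - 1)\<^sup>2"
    by (simp add: power_mult_distrib power2_commute[of v 1] power_divide)
  have "0 \<le> (s + 1)\<^sup>2" "0 \<le> ((s\<^sup>2 - 1) - 1 / 2)\<^sup>2"
    by auto
  then have "- s \<le> (s\<^sup>2 + 1) / 2" "s\<^sup>2 - 1 \<le> (s\<^sup>2 - 1)\<^sup>2 + 1 / 4"
    by (simp_all add: power2_eq_square algebra_simps)
  \<comment> \<open>Here \<open>x\<close> stands for s^2 and \<open>y\<close> for (s^2 - 1)^2, so
    that the combination is linear.\<close>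
  moreover have "- s \<le> 9 / 8 + y / 2" if "- s \<le> (x + 1) / 2" "x - 1 \<le> y + 1 / 4" for x y :: real
    using that by (simp add: field_simps)
  ultimately have "- s \<le> 9 / 8 + (s\<^sup>2 - 1)\<^sup>2 / 2"
    by blast
  moreover have "0 \<le> (s\<^sup>2 - 1)\<^sup>2" by simp
  moreover have "(v - s) / 72 \<le> p + q" if "- s \<le> 9 / 8 + q / 2" "0 \<le> q" "9 / 256 \<le> p" for p q
    using that assms by argo
  ultimately show ?thesis
    using 1 by blast
qed

text \<open>The cases yield the bounds 1, 1, 1/256 and 1/144; the constant 1/1000 lies below all of
  them.\<close>

lemma barron_J_ge:
  assumes "u \<in> barron_space"
  shows "ennreal (1 / 1000) \<le> J u"
proof (rule barron_spaceE[OF assms])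
  fix g L C
  assume g: "g \<in> borel_measurable borel" "\<And>x. \<bar>g x\<bar> \<le> C" and gL: "(g \<longlongrightarrow> L) (at_right 0)"
    and lip: "\<And>x y. \<bar>u x - u y\<bar> \<le> C * \<bar>x - y\<bar>"
    and parts: "\<And>a b \<phi> \<phi>'. a \<le> b \<Longrightarrow> (\<And>x. x \<in> {a..b} \<Longrightarrow> (\<phi> has_real_derivative \<phi>' x) (at x)) \<Longrightarrow>
      continuous_on {a..b} \<phi>' \<Longrightarrow> \<phi> \<in> borel_measurable borel \<Longrightarrow> \<phi>' \<in> borel_measurable borel \<Longrightarrow>
      ((\<lambda>x. u x * \<phi>' x + g x * \<phi> x) has_integral u b * \<phi> b - u a * \<phi> a) {a..b}"
  have "0 \<le> C"
    using g(2)[of 0] by linarith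
  have "C-lipschitz_on UNIV u"
    using lip \<open>0 \<le> C\<close> by (intro lipschitz_onI) (auto simp: dist_real_def)
  then have cont: "continuous_on S u" for S
    using lipschitz_on_continuous_on continuous_on_subset by blast
  then have u_meas: "u \<in> borel_measurable borel"
    by (intro borel_measurable_continuous_onI)
  define K where "K = \<bar>u 0\<bar> + C"
  have u_bound: "\<bar>u x\<bar> \<le> K" if "x \<in> {0<..<1}" for x
    using lip[of x 0] mult_left_mono[of x 1 C] that \<open>0 \<le> C\<close> by (auto simp: K_def)
  have g_bound: "\<bar>g x\<bar> \<le> K" for x
    using g(2)[of x] by (simp add: K_def)
  have weak: "has_weak_deriv {0<..<1} u g"
    by (rule has_weak_derivI[OF u_meas u_bound g(1) g_bound])
      (auto intro!: parts smooth_DERIV smooth_continuous_on smooth_deriv borel_measurable_continuous_onI)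
  define f where "f x = (u x)\<^sup>2 * (u x - x)\<^sup>2 / x ^ 5 + ((g x)\<^sup>2 - 1)\<^sup>2 / x + (u x)\<^sup>2" for x
  have J: "J u = (\<integral>\<^sup>+x. ennreal (f x) \<partial>lebesgue_on {0<..<1})"
    unfolding f_def by (rule J_eq[OF weak])
  \<comment> \<open>In terms of v = u/x the first term carries the same weight 1/x as the second,
    which is the scale invariance behind the estimate.\<close>
  have f_ge: "((u x / x)\<^sup>2 * (u x / x - 1)\<^sup>2 + ((g x)\<^sup>2 - 1)\<^sup>2) / x \<le> f x" if "x > 0" for x
  proof -
    have "(u x)\<^sup>2 * (u x - x)\<^sup>2 / x ^ 5 = (u x / x)\<^sup>2 * (u x / x - 1)\<^sup>2 / x"
      using that by (simp add: field_simps eval_nat_numeral)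
    then show ?thesis
      by (simp add: f_def add_divide_distrib)
  qed
  consider "u 0 \<noteq> 0" | "u 0 = 0" "L \<noteq> 1" | "u 0 = 0" "L = 1"
    by blast
  then show ?thesis
  proof cases
    case 1
    have "(u \<longlongrightarrow> u 0) (at_right 0)"
      using cont[of UNIV] by (auto simp: continuous_on_def intro: tendsto_within_subset)
    then have "((\<lambda>x. (u x)\<^sup>2 * (u x - x)\<^sup>2) \<longlongrightarrow> (u 0)\<^sup>2 * (u 0 - 0)\<^sup>2) (at_right 0)"
      by (intro tendsto_intros)
    moreover have "(u 0)\<^sup>2 * (u 0 - 0)\<^sup>2 > (u 0) ^ 4 / 2"
    proof -
      have "(u 0)\<^sup>2 * (u 0 - 0)\<^sup>2 = (u 0) ^ 4" "(u 0) ^ 4 > 0"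
        using 1 by (simp add: power2_eq_square power4_eq_xxxx, simp add: zero_less_power_eq)
      then show ?thesis by linarith
    qed
    ultimately have "\<forall>\<^sub>F x in at_right 0. (u 0) ^ 4 / 2 < (u x)\<^sup>2 * (u x - x)\<^sup>2"
      by (rule order_tendstoD(1))
    moreover have "\<forall>\<^sub>F x in at_right 0. x \<in> {0<..<1::real}"
      by (rule eventually_at_right_real) simp
    ultimately have "\<forall>\<^sub>F x in at_right 0. ((u 0) ^ 4 / 2) / x \<le> f x"
    proof eventually_elim
      case (elim x)
      have "x ^ 5 \<le> x"
        using elim(2) power_decreasing[of 1 5 x] by simp
      then have "((u 0) ^ 4 / 2) / x \<le> (u x)\<^sup>2 * (u x - x)\<^sup>2 / x ^ 5"
        using elim by (intro frac_le) auto
      also have "\<dots> \<le> f x"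
        using elim by (simp add: f_def)
      finally show ?case .
    qed
    then have "1 \<le> J u"
      unfolding J by (rule nn_integral_ge_of_pole[rotated]) (use 1 in \<open>simp add: zero_less_power_eq\<close>)
    then show ?thesis
      by (rule order_trans[rotated]) simp
  next
    case 2
    \<comment> \<open>Integration by parts with \<phi> = 1, using u(0) = 0.\<close>
    have "(g has_integral u x) {0..x}" if "0 < x" for x
      using parts[of 0 x "\<lambda>_. 1" "\<lambda>_. 0"] that 2 by simp
    then have uL: "((\<lambda>x. u x / x) \<longlongrightarrow> L) (at_right 0)"
      using gL by (rule tendsto_slope_at_0)
    \<comment> \<open>The second square vanishes only for L = 1 and L = -1, and the first excludes
      -1. So \<open>c\<close> is positive unless L = 1, and the integrand has a pole of order
      one.\<close>
    define c where "c = L\<^sup>2 * (L - 1)\<^sup>2 + (L\<^sup>2 - 1)\<^sup>2"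
    have "c > 0"
    proof -
      have "c \<noteq> 0"
      proof
        assume "c = 0"
        then have "L = 1"
          unfolding c_def by (auto simp: add_nonneg_eq_0_iff)
        then show False using 2 by simp
      qed
      moreover have "c \<ge> 0" by (simp add: c_def)
      ultimately show ?thesis by simp
    qed
    have "((\<lambda>x. (u x / x)\<^sup>2 * (u x / x - 1)\<^sup>2 + ((g x)\<^sup>2 - 1)\<^sup>2) \<longlongrightarrow> c) (at_right 0)"
      unfolding c_def by (intro tendsto_intros uL gL)
    then have "\<forall>\<^sub>F x in at_right 0. c / 2 < (u x / x)\<^sup>2 * (u x / x - 1)\<^sup>2 + ((g x)\<^sup>2 - 1)\<^sup>2"
      using \<open>c > 0\<close> by (intro order_tendstoD(1)) auto
    moreover have "\<forall>\<^sub>F x in at_right 0. x \<in> {0<..<1::real}"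
      by (rule eventually_at_right_real) simp
    ultimately have "\<forall>\<^sub>F x in at_right 0. (c / 2) / x \<le> f x"
    proof eventually_elim
      case (elim x)
      then show ?case
        by (intro order_trans[OF divide_right_mono f_ge]) auto
    qed
    then have "1 \<le> J u"
      unfolding J by (rule nn_integral_ge_of_pole[rotated]) (use \<open>c > 0\<close> in simp)
    then show ?thesis
      by (rule order_trans[rotated]) simp
  next
    case 3
    have "(g has_integral u x) {0..x}" if "0 < x" for x
      using parts[of 0 x "\<lambda>_. 1" "\<lambda>_. 0"] that 3 by simp
    then have v1: "((\<lambda>x. u x / x) \<longlongrightarrow> 1) (at_right 0)"
      using gL 3 by (intro tendsto_slope_at_0) auto
    show ?thesis
    proof (cases "\<forall>x\<in>{0<..<1}. u x / x > 1 / 4")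
      case True
      \<comment> \<open>On (1/2, 3/4) one has u > x/4 \<ge> 1/8, so the term u^2 alone contributes
        1/64 over a length of 1/4.\<close>
      have "ennreal (1 / 64 * (1 / 4)) \<le> J u"
        unfolding J
      proof (rule nn_integral_ge_integral[of "\<lambda>_. 1 / 64" "1 / 2" "3 / 4" "1 / 64"])
        show "((\<lambda>_. 1 / 64 :: real) has_integral 1 / 64 * (1 / 4)) {1 / 2..3 / 4::real}"
          using has_integral_const_real[of "1 / 64 :: real" "1 / 2" "3 / 4"] by simp
        fix x :: real assume x: "x \<in> {1 / 2<..<3 / 4}"
        then have "1 / 4 < u x / x"
          using True by auto
        then have "1 / 8 \<le> u x"
          using x by (simp add: field_simps)
        then have "(1 / 8)\<^sup>2 \<le> (u x)\<^sup>2"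
          by (intro power_mono) auto
        also have "\<dots> \<le> f x"
          using x by (simp add: f_def)
        finally show "1 / 64 \<le> f x"
          by (simp add: power_divide)
      qed auto
      then show ?thesis
        by (rule order_trans[rotated]) (simp add: ennreal_leI)
    next
      case False
      then obtain t where t: "t \<in> {0<..<1}" "u t / t \<le> 1 / 4"
        by force
      have "\<forall>\<^sub>F x in at_right 0. 3 / 4 < u x / x"
        using v1 by (rule order_tendstoD(1)) simp
      moreover have "\<forall>\<^sub>F x in at_right 0. x \<in> {0<..<t}"
        using t by (intro eventually_at_right_real) simp
      ultimately have "\<forall>\<^sub>F x in at_right 0. 3 / 4 < u x / x \<and> x \<in> {0<..<t}"
        by (rule eventually_conj)
      then obtain s where s: "3 / 4 < u s / s" "s \<in> {0<..<t}"
        using eventually_happens'[of "at_right (0::real)"] by auto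
      have "continuous_on {s..t} (\<lambda>x. u x / x)"
        using s by (intro continuous_intros cont) auto
      then obtain a b where ab: "s \<le> a" "a < b" "b \<le> t" "u a / a \<ge> 3 / 4" "u b / b \<le> 1 / 4"
        and mid: "\<And>x. x \<in> {a<..<b} \<Longrightarrow> 1 / 4 < u x / x \<and> u x / x < 3 / 4"
        using crossing_interval[of s t "\<lambda>x. u x / x" "3 / 4" "1 / 4"] s t by auto
      have a0: "0 < a" "b < 1"
        using ab s t by auto
      let ?h = "\<lambda>x. (u x / x - g x) / x / 72"
      \<comment> \<open>Integration by parts with \<phi> = 1/x: the integrand is (g - u/x)/x, the
        derivative of u/x. Rescaled by -1/72 it becomes the minorant \<open>?h\<close> of
        \<open>f\<close>.\<close>
      have "((\<lambda>x. u x * (- (1 / x\<^sup>2)) + g x * (1 / x)) has_integral u b * (1 / b) - u a * (1 / a)) {a..b}"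
        using ab a0 by (intro parts) (auto intro!: derivative_eq_intros continuous_intros simp: power2_eq_square)
      from has_integral_mult_right[OF this, of "- (1 / 72)"]
      have int: "(?h has_integral (u a / a - u b / b) / 72) {a..b}"
        by (rule has_integral_eq_rhs[OF has_integral_eq[rotated]])
          (use a0 in \<open>auto simp: field_simps power2_eq_square\<close>)
      have "ennreal ((u a / a - u b / b) / 72) \<le> J u"
        unfolding J
      proof (rule nn_integral_ge_integral[OF _ _ _ _ _ int])
        show "?h \<in> borel_measurable borel"
          using u_meas g(1) by measurable
        show "\<bar>?h x\<bar> \<le> (K / a + K) / a / 72" if x: "x \<in> {a..b}" for x
        proof -
          have "\<bar>u x / x - g x\<bar> \<le> \<bar>u x\<bar> / x + \<bar>g x\<bar>"
            using x a0 by (intro order_trans[OF abs_triangle_ineq4]) auto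
          also have "\<dots> \<le> K / a + K"
            using x a0 u_bound[of x] g_bound[of x] by (intro add_mono frac_le) auto
          finally have "\<bar>u x / x - g x\<bar> / x / 72 \<le> (K / a + K) / a / 72"
            using x a0 by (intro divide_right_mono frac_le) auto
          then show ?thesis
            using x a0 by simp
        qed
        show "?h x \<le> f x" if x: "x \<in> {a<..<b}" for x
        proof -
          have "?h x = (u x / x - g x) / 72 / x"
            by simp
          also have "\<dots> \<le> ((u x / x)\<^sup>2 * (u x / x - 1)\<^sup>2 + ((g x)\<^sup>2 - 1)\<^sup>2) / x"
            using mid[OF x] x a0 by (intro divide_right_mono transition_cost) auto
          also have "\<dots> \<le> f x"
            using x a0 by (intro f_ge) simp
          finally show ?thesis .
        qed
      qed (use a0 in auto)
      then show ?thesis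
        by (rule order_trans[rotated]) (use ab in \<open>auto intro!: ennreal_leI\<close>)
    qed
  qed
qed

theorem theorem6:
  shows "(INF u \<in> sobolev1 \<infinity> {0<..<1}. J u) = (INF u \<in> sobolev1 4 {0<..<1}. J u)
    \<and> (INF u \<in> sobolev1 4 {0<..<1}. J u) = 0
    \<and> (INF u \<in> barron_space. J u) > 0"
proof -
  have "ennreal (1 / 1000) \<le> (INF u \<in> barron_space. J u)"
    by (intro INF_greatest barron_J_ge)
  then have "(INF u \<in> barron_space. J u) > 0"
    by (rule less_le_trans[rotated]) simp
  then show ?thesis
    by (simp add: INF_J_sobolev1)
qed

end
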